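(* Let $n\geq2$ and consider the triplet of full subcategories $$(Ker(\mathbf{cot}_{n-1}),\;Crs(Grp)_{n-1\geq},\;Crs(Grp)_{\geq n})$$ of the category $Crs(Grp)$ of reduced crossed complexes. Then: (1) the pair $(Ker(\mathbf{cot}_{n-1}),Crs(Grp)_{n-1\geq})$ is a CTF theory, i.e. (it is a torsion theory and) the subcategory $Crs(Grp)_{n-1\geq}$ is mono-coreflective; (2) the pair $(Crs(Grp)_{n-1\geq},Crs(Grp)_{\geq n})$ is an $\mathcal{E}$-torsion theory, where $\mathcal{E}$ is the class of crossed complexes $M$ with all actions $M_0\to Aut(M_i)$ trivial for $i\geq n$; (3) if $M$ is a crossed complex such that the crossed module $\delta_1:M_1\to M_0$ is a central extension, then $M$ belongs to $\mathcal{E}$. In particular, for $n=2$ this holds for the triplet $(Ker(\mathbf{cot}_1),\mathbb{X}Mod,chn(Ab)_{\geq2})$.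
   Context: A crossed module is a group homomorphism $\delta:A\to B$ with an action of $B$ on $A$ by automorphisms such that $\delta({}^ba)=b\delta(a)b^{-1}$ and ${}^{\delta(a)}a'=aa'a^{-1}$; $\mathbb{X}Mod$ is the category of crossed modules. A reduced crossed complex is a chain complex of groups $\dots\to M_n\xrightarrow{\delta_n}M_{n-1}\to\dots\to M_1\xrightarrow{\delta_1}M_0$ which is proper (the image of each $\delta_n$ is normal in $M_{n-1}$), with $M_n$ abelian for $n\geq2$, with actions of $M_0$ on $M_n$ for $n\geq1$ such that $\delta_1(M_1)$ acts trivially on $M_n$ for $n\geq2$, all $\delta_n$ preserving the action of $M_0$, and $\delta_1$ a crossed module. Morphisms are chain morphisms preserving all actions; the category is $Crs(Grp)$ (a semi-abelian category). $Crs(Grp)_{k\geq}$ is the category of $k$-truncated reduced crossed complexes, identified with the full subcategory of $M$ with $M_i=0$ for $i>k$ (embedding $\mathbf{sk}_k$); $Crs(Grp)_{1\geq}=\mathbb{X}Mod$. $Crs(Grp)_{\geq k}$ is the full subcategory of $M$ with $M_i=0$ for $i<k$; for $k\geq1$ it is equivalent to the category $chn(Ab)_{\geq k}$ of chain complexes of abelian groups trivial below degree $k$. The functor $\mathbf{cot}_k:Crs(Grp)\to Crs(Grp)_{k\geq}$, left adjoint of $\mathbf{sk}_k$, sends $M$ to $M_k/\delta_{k+1}(M_{k+1})\to M_{k-1}\to M_{k-2}\to\cdots$; $Ker(\mathbf{cot}_k)$ is the full subcategory of $M$ with $\mathbf{cot}_k(M)=0$. A torsion theory in a category $\mathbb{X}$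 is a pair $(\mathcal{T},\mathcal{F})$ of full replete subcategories such that every morphism from an object of $\mathcal{T}$ to an object of $\mathcal{F}$ is zero (TT1), and every object $X$ admits a short exact sequence $0\to T_X\to X\to F_X\to0$ with $T_X\in\mathcal{T}$, $F_X\in\mathcal{F}$ (TT2). For a class $\mathcal{E}$ of objects, an $\mathcal{E}$-torsion theory is a pair $(\mathcal{T},\mathcal{F})$ of full subcategories satisfying TT1 and such that every $X\in\mathcal{E}$ admits such a short exact sequence. A CTF theory is a torsion theory $(\mathcal{T},\mathcal{F})$ with $\mathcal{F}$ mono-coreflective: the inclusion of $\mathcal{F}$ has a right adjoint and the components of the counit are monomorphisms. A central extension is a surjective group homomorphism with kernel contained in the center of its domain. *)

theory Defs
  imports "HOL-Algebra.Elementary_Groups" "HOL-Algebra.Bij"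
begin

section \<open>Categories, functors, adjunctions\<close>

text \<open>
  Morphisms do not carry their source and target, so composition is indexed by three objects:
  \<open>Comp C X Y Z g f\<close> is \<open>g \<circ> f\<close> for \<open>f : X \<rightarrow> Y\<close> and \<open>g : Y \<rightarrow> Z\<close>.
\<close>

record ('o, 'm) cat =
  Ob :: "'o set"
  Hom :: "'o \<Rightarrow> 'o \<Rightarrow> 'm set"
  Id :: "'o \<Rightarrow> 'm"
  Comp :: "'o \<Rightarrow> 'o \<Rightarrow> 'o \<Rightarrow> 'm \<Rightarrow> 'm \<Rightarrow> 'm"

definition category :: "('o, 'm) cat \<Rightarrow> bool" where
  "category C \<longleftrightarrow>
     (\<forall>X\<in>Ob C. Id C X \<in> Hom C X X) \<and>
     (\<forall>X\<in>Ob C. \<forall>Y\<in>Ob C. \<forall>Z\<in>Ob C. \<forall>f\<in>Hom C X Y. \<forall>g\<in>Hom C Y Z.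
        Comp C X Y Z g f \<in> Hom C X Z) \<and>
     (\<forall>X\<in>Ob C. \<forall>Y\<in>Ob C. \<forall>f\<in>Hom C X Y.
        Comp C X X Y f (Id C X) = f \<and> Comp C X Y Y (Id C Y) f = f) \<and>
     (\<forall>W\<in>Ob C. \<forall>X\<in>Ob C. \<forall>Y\<in>Ob C. \<forall>Z\<in>Ob C.
        \<forall>f\<in>Hom C W X. \<forall>g\<in>Hom C X Y. \<forall>h\<in>Hom C Y Z.
        Comp C W Y Z h (Comp C W X Y g f) = Comp C W X Z (Comp C X Y Z h g) f)"

definition isomorphic :: "('o, 'm) cat \<Rightarrow> 'o \<Rightarrow> 'o \<Rightarrow> bool" where
  "isomorphic C X Y \<longleftrightarrow>
     (\<exists>f\<in>Hom C X Y. \<exists>g\<in>Hom C Y X. Comp C X Y X g f = Id C X \<and> Comp C Y X Y f g = Id C Y)"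

definition monomorphism :: "('o, 'm) cat \<Rightarrow> 'o \<Rightarrow> 'o \<Rightarrow> 'm \<Rightarrow> bool" where
  "monomorphism C X Y m \<longleftrightarrow> m \<in> Hom C X Y \<and>
     (\<forall>W\<in>Ob C. \<forall>g\<in>Hom C W X. \<forall>h\<in>Hom C W X. Comp C W X Y m g = Comp C W X Y m h \<longrightarrow> g = h)"

definition zero_object :: "('o, 'm) cat \<Rightarrow> 'o \<Rightarrow> bool" where
  "zero_object C Z \<longleftrightarrow> Z \<in> Ob C \<and>
     (\<forall>X\<in>Ob C. (\<exists>!f. f \<in> Hom C Z X) \<and> (\<exists>!f. f \<in> Hom C X Z))"

definition zero_morphism :: "('o, 'm) cat \<Rightarrow> 'o \<Rightarrow> 'o \<Rightarrow> 'm \<Rightarrow> bool" where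
  "zero_morphism C X Y f \<longleftrightarrow>
     (\<exists>Z g h. zero_object C Z \<and> g \<in> Hom C X Z \<and> h \<in> Hom C Z Y \<and> f = Comp C X Z Y h g)"

definition is_kernel :: "('o, 'm) cat \<Rightarrow> 'o \<Rightarrow> 'o \<Rightarrow> 'o \<Rightarrow> 'm \<Rightarrow> 'm \<Rightarrow> bool" where
  "is_kernel C K X Y k f \<longleftrightarrow> K \<in> Ob C \<and> k \<in> Hom C K X \<and> f \<in> Hom C X Y \<and>
     zero_morphism C K Y (Comp C K X Y f k) \<and>
     (\<forall>W\<in>Ob C. \<forall>h\<in>Hom C W X. zero_morphism C W Y (Comp C W X Y f h) \<longrightarrow>
        (\<exists>!u. u \<in> Hom C W K \<and> Comp C W K X k u = h))"

definition is_cokernel :: "('o, 'm) cat \<Rightarrow> 'o \<Rightarrow> 'o \<Rightarrow> 'o \<Rightarrow> 'm \<Rightarrow> 'm \<Rightarrow> bool" where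
  "is_cokernel C X Y Q f q \<longleftrightarrow> Q \<in> Ob C \<and> f \<in> Hom C X Y \<and> q \<in> Hom C Y Q \<and>
     zero_morphism C X Q (Comp C X Y Q q f) \<and>
     (\<forall>W\<in>Ob C. \<forall>h\<in>Hom C Y W. zero_morphism C X W (Comp C X Y W h f) \<longrightarrow>
        (\<exists>!u. u \<in> Hom C Q W \<and> Comp C Y Q W u q = h))"

definition short_exact :: "('o, 'm) cat \<Rightarrow> 'o \<Rightarrow> 'o \<Rightarrow> 'o \<Rightarrow> 'm \<Rightarrow> 'm \<Rightarrow> bool" where
  "short_exact C T X F t q \<longleftrightarrow> is_kernel C T X F t q \<and> is_cokernel C T X F t q"

record ('o, 'm, 'p, 'n) cfunctor =
  FOb :: "'o \<Rightarrow> 'p"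
  FHom :: "'o \<Rightarrow> 'o \<Rightarrow> 'm \<Rightarrow> 'n"

definition is_functor :: "('o, 'm) cat \<Rightarrow> ('p, 'n) cat \<Rightarrow> ('o, 'm, 'p, 'n) cfunctor \<Rightarrow> bool" where
  "is_functor C D G \<longleftrightarrow>
     (\<forall>X\<in>Ob C. FOb G X \<in> Ob D) \<and>
     (\<forall>X\<in>Ob C. \<forall>Y\<in>Ob C. \<forall>f\<in>Hom C X Y. FHom G X Y f \<in> Hom D (FOb G X) (FOb G Y)) \<and>
     (\<forall>X\<in>Ob C. FHom G X X (Id C X) = Id D (FOb G X)) \<and>
     (\<forall>X\<in>Ob C. \<forall>Y\<in>Ob C. \<forall>Z\<in>Ob C. \<forall>f\<in>Hom C X Y. \<forall>g\<in>Hom C Y Z.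
        FHom G X Z (Comp C X Y Z g f) =
        Comp D (FOb G X) (FOb G Y) (FOb G Z) (FHom G Y Z g) (FHom G X Y f))"

definition fully_faithful :: "('o, 'm) cat \<Rightarrow> ('p, 'n) cat \<Rightarrow> ('o, 'm, 'p, 'n) cfunctor \<Rightarrow> bool" where
  "fully_faithful C D G \<longleftrightarrow> is_functor C D G \<and>
     (\<forall>X\<in>Ob C. \<forall>Y\<in>Ob C. bij_betw (FHom G X Y) (Hom C X Y) (Hom D (FOb G X) (FOb G Y)))"

definition essential_image ::
  "('o, 'm) cat \<Rightarrow> ('p, 'n) cat \<Rightarrow> ('o, 'm, 'p, 'n) cfunctor \<Rightarrow> 'p set" where
  "essential_image C D G = {Y \<in> Ob D. \<exists>X\<in>Ob C. isomorphic D Y (FOb G X)}"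

text \<open>\<open>R : C \<rightarrow> D\<close> is right adjoint to \<open>L : D \<rightarrow> C\<close> with counit \<open>\<epsilon> : L R \<Rightarrow> 1\<close>.\<close>

definition adjunction ::
  "('o, 'm) cat \<Rightarrow> ('p, 'n) cat \<Rightarrow> ('p, 'n, 'o, 'm) cfunctor \<Rightarrow> ('o, 'm, 'p, 'n) cfunctor
     \<Rightarrow> ('o \<Rightarrow> 'm) \<Rightarrow> bool" where
  "adjunction C D L R \<epsilon> \<longleftrightarrow> is_functor D C L \<and> is_functor C D R \<and>
     (\<forall>X\<in>Ob C. \<epsilon> X \<in> Hom C (FOb L (FOb R X)) X) \<and>
     (\<forall>X\<in>Ob C. \<forall>Y\<in>Ob C. \<forall>f\<in>Hom C X Y.
        Comp C (FOb L (FOb R X)) (FOb L (FOb R Y)) Y (\<epsilon> Y)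
          (FHom L (FOb R X) (FOb R Y) (FHom R X Y f)) =
        Comp C (FOb L (FOb R X)) X Y f (\<epsilon> X)) \<and>
     (\<forall>A\<in>Ob D. \<forall>X\<in>Ob C. \<forall>f\<in>Hom C (FOb L A) X.
        \<exists>!g. g \<in> Hom D A (FOb R X) \<and>
             Comp C (FOb L A) (FOb L (FOb R X)) X (\<epsilon> X) (FHom L A (FOb R X) g) = f)"

text \<open>A full subcategory is given by its set of objects.\<close>

definition full_subcat :: "('o, 'm) cat \<Rightarrow> 'o set \<Rightarrow> ('o, 'm) cat" where
  "full_subcat C S = C\<lparr>Ob := S\<rparr>"

definition inclusion_functor :: "('o, 'm, 'o, 'm) cfunctor" where
  "inclusion_functor = \<lparr>FOb = (\<lambda>X. X), FHom = (\<lambda>X Y f. f)\<rparr>"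

definition replete :: "('o, 'm) cat \<Rightarrow> 'o set \<Rightarrow> bool" where
  "replete C S \<longleftrightarrow> S \<subseteq> Ob C \<and> (\<forall>X\<in>S. \<forall>Y\<in>Ob C. isomorphic C X Y \<longrightarrow> Y \<in> S)"

definition mono_coreflective :: "('o, 'm) cat \<Rightarrow> 'o set \<Rightarrow> bool" where
  "mono_coreflective C S \<longleftrightarrow> S \<subseteq> Ob C \<and>
     (\<exists>R \<epsilon>. adjunction C (full_subcat C S) inclusion_functor R \<epsilon> \<and>
        (\<forall>X\<in>Ob C. monomorphism C (FOb R X) X (\<epsilon> X)))"


section \<open>Torsion theories\<close>

definition TT1 :: "('o, 'm) cat \<Rightarrow> 'o set \<Rightarrow> 'o set \<Rightarrow> bool" where
  "TT1 C \<T> \<F> \<longleftrightarrow> (\<forall>T\<in>\<T>. \<forall>F\<in>\<F>. \<forall>f\<in>Hom C T F. zero_morphism C T F f)"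

definition TT2_on :: "('o, 'm) cat \<Rightarrow> 'o set \<Rightarrow> 'o set \<Rightarrow> 'o set \<Rightarrow> bool" where
  "TT2_on C \<E> \<T> \<F> \<longleftrightarrow> (\<forall>X\<in>\<E>. \<exists>T\<in>\<T>. \<exists>F\<in>\<F>. \<exists>t q. short_exact C T X F t q)"

definition torsion_theory :: "('o, 'm) cat \<Rightarrow> 'o set \<Rightarrow> 'o set \<Rightarrow> bool" where
  "torsion_theory C \<T> \<F> \<longleftrightarrow>
     replete C \<T> \<and> replete C \<F> \<and> TT1 C \<T> \<F> \<and> TT2_on C (Ob C) \<T> \<F>"

definition E_torsion_theory :: "('o, 'm) cat \<Rightarrow> 'o set \<Rightarrow> 'o set \<Rightarrow> 'o set \<Rightarrow> bool" where
  "E_torsion_theory C \<E> \<T> \<F> \<longleftrightarrow>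
     \<E> \<subseteq> Ob C \<and> \<T> \<subseteq> Ob C \<and> \<F> \<subseteq> Ob C \<and> TT1 C \<T> \<F> \<and> TT2_on C \<E> \<T> \<F>"

definition CTF_theory :: "('o, 'm) cat \<Rightarrow> 'o set \<Rightarrow> 'o set \<Rightarrow> bool" where
  "CTF_theory C \<T> \<F> \<longleftrightarrow> torsion_theory C \<T> \<F> \<and> mono_coreflective C \<F>"


section \<open>Crossed modules and reduced crossed complexes\<close>

definition crossed_module ::
  "'a monoid \<Rightarrow> 'b monoid \<Rightarrow> ('a \<Rightarrow> 'b) \<Rightarrow> ('b \<Rightarrow> 'a \<Rightarrow> 'a) \<Rightarrow> bool" where
  "crossed_module A B d \<phi> \<longleftrightarrow> group A \<and> group B \<and> d \<in> hom A B \<and> \<phi> \<in> hom B (AutoGroup A) \<and>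
     (\<forall>b\<in>carrier B. \<forall>a\<in>carrier A. d (\<phi> b a) = b \<otimes>\<^bsub>B\<^esub> d a \<otimes>\<^bsub>B\<^esub> inv\<^bsub>B\<^esub> b) \<and>
     (\<forall>a\<in>carrier A. \<forall>a'\<in>carrier A. \<phi> (d a) a' = a \<otimes>\<^bsub>A\<^esub> a' \<otimes>\<^bsub>A\<^esub> inv\<^bsub>A\<^esub> a)"

definition central_extension :: "'a monoid \<Rightarrow> 'b monoid \<Rightarrow> ('a \<Rightarrow> 'b) \<Rightarrow> bool" where
  "central_extension A B d \<longleftrightarrow> group A \<and> group B \<and> d \<in> hom A B \<and> d ` carrier A = carrier B \<and>
     (\<forall>z\<in>kernel A B d. \<forall>a\<in>carrier A. z \<otimes>\<^bsub>A\<^esub> a = a \<otimes>\<^bsub>A\<^esub> z)"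

text \<open>
  The groups are \<open>M\<^sub>n = lev M n\<close>, the differentials \<open>\<delta>\<^sub>n = bd M n : M\<^sub>n \<rightarrow> M\<^sub>n\<^sub>-\<^sub>1\<close> and the actions
  \<open>act M n : M\<^sub>0 \<rightarrow> Aut M\<^sub>n\<close>, both for \<open>n \<ge> 1\<close> only; \<open>bd M 0\<close> and \<open>act M 0\<close> are
  irrelevant. The type \<open>'a\<close> of group elements plays the role of the universe.
\<close>

record 'a crs =
  lev :: "nat \<Rightarrow> 'a monoid"
  bd :: "nat \<Rightarrow> 'a \<Rightarrow> 'a"
  act :: "nat \<Rightarrow> 'a \<Rightarrow> 'a \<Rightarrow> 'a"

definition crossed_complex :: "'a crs \<Rightarrow> bool" where
  "crossed_complex M \<longleftrightarrow>
     (\<forall>n. group (lev M n)) \<and>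
     (\<forall>n\<ge>2. comm_group (lev M n)) \<and>
     (\<forall>n\<ge>1. bd M n \<in> hom (lev M n) (lev M (n - 1))) \<and>
     (\<forall>n\<ge>1. \<forall>x\<in>carrier (lev M (n + 1)). bd M n (bd M (n + 1) x) = \<one>\<^bsub>lev M (n - 1)\<^esub>) \<and>
     (\<forall>n\<ge>1. bd M n ` carrier (lev M n) \<lhd> lev M (n - 1)) \<and>
     (\<forall>n\<ge>1. act M n \<in> hom (lev M 0) (AutoGroup (lev M n))) \<and>
     (\<forall>n\<ge>2. \<forall>x\<in>carrier (lev M 1). act M n (bd M 1 x) = \<one>\<^bsub>AutoGroup (lev M n)\<^esub>) \<and>
     (\<forall>n\<ge>2. \<forall>b\<in>carrier (lev M 0). \<forall>x\<in>carrier (lev M n).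
        bd M n (act M n b x) = act M (n - 1) b (bd M n x)) \<and>
     crossed_module (lev M 1) (lev M 0) (bd M 1) (act M 1)"

text \<open>
  Components of morphisms are required to be extensional, so that equality of morphisms is
  equality on the underlying sets.
\<close>

definition crs_hom :: "'a crs \<Rightarrow> 'a crs \<Rightarrow> (nat \<Rightarrow> 'a \<Rightarrow> 'a) set" where
  "crs_hom M N = {f.
     (\<forall>n. f n \<in> hom (lev M n) (lev N n) \<inter> extensional (carrier (lev M n))) \<and>
     (\<forall>n\<ge>1. \<forall>x\<in>carrier (lev M n). f (n - 1) (bd M n x) = bd N n (f n x)) \<and>
     (\<forall>n\<ge>1. \<forall>b\<in>carrier (lev M 0). \<forall>x\<in>carrier (lev M n).
        f n (act M n b x) = act N n (f 0 b) (f n x))}"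

definition Crs :: "('a crs, nat \<Rightarrow> 'a \<Rightarrow> 'a) cat" where
  "Crs = \<lparr>Ob = {M. crossed_complex M}, Hom = crs_hom,
          Id = (\<lambda>M n. \<lambda>x\<in>carrier (lev M n). x),
          Comp = (\<lambda>M N P g f n. compose (carrier (lev M n)) (g n) (f n))\<rparr>"

definition Crs_le :: "nat \<Rightarrow> 'a crs set" where
  "Crs_le k = {M \<in> Ob Crs. \<forall>i>k. trivial_group (lev M i)}"

definition Crs_ge :: "nat \<Rightarrow> 'a crs set" where
  "Crs_ge k = {M \<in> Ob Crs. \<forall>i<k. trivial_group (lev M i)}"

definition Crs_trivial_act :: "nat \<Rightarrow> 'a crs set" where
  "Crs_trivial_act n =
     {M \<in> Ob Crs. \<forall>i\<ge>n. \<forall>b\<in>carrier (lev M 0). act M i b = \<one>\<^bsub>AutoGroup (lev M i)\<^esub>}"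


section \<open>The functor \<open>cot\<close>\<close>

text \<open>
  To stay within crossed complexes over the type \<open>'a\<close>, the quotient \<open>G Mod N\<close> is carried along
  a choice of coset representatives; \<open>rep_Mod_iso\<close> below states that nothing is lost.
\<close>

definition rep :: "'a set \<Rightarrow> 'a" where
  "rep X = (SOME x. x \<in> X)"

definition rep_Mod :: "('a, 'b) monoid_scheme \<Rightarrow> 'a set \<Rightarrow> 'a monoid" where
  "rep_Mod G N =
     \<lparr>carrier = rep ` carrier (G Mod N),
      mult = (\<lambda>x y. rep ((N #>\<^bsub>G\<^esub> x) \<otimes>\<^bsub>G Mod N\<^esub> (N #>\<^bsub>G\<^esub> y))),
      one = rep \<one>\<^bsub>G Mod N\<^esub>\<rparr>"

definition bd_image :: "'a crs \<Rightarrow> nat \<Rightarrow> 'a set" where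
  "bd_image M k = bd M (k + 1) ` carrier (lev M (k + 1))"

definition cot_lev :: "nat \<Rightarrow> 'a crs \<Rightarrow> nat \<Rightarrow> 'a monoid" where
  "cot_lev k M i =
     (if i < k then lev M i
      else if i = k then rep_Mod (lev M k) (bd_image M k)
      else singleton_group \<one>\<^bsub>lev M i\<^esub>)"

definition cot :: "nat \<Rightarrow> 'a crs \<Rightarrow> 'a crs" where
  "cot k M =
     \<lparr>lev = cot_lev k M,
      bd = (\<lambda>i x. if i \<le> k then bd M i x else \<one>\<^bsub>cot_lev k M (i - 1)\<^esub>),
      act = (\<lambda>i b.
        if i < k then act M i b
        else if i = k then
          (\<lambda>x\<in>carrier (cot_lev k M k). rep (bd_image M k #>\<^bsub>lev M k\<^esub> act M k b x))
        else (\<lambda>x\<in>carrier (cot_lev k M i). x))\<rparr>"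

definition Ker_cot :: "nat \<Rightarrow> 'a crs set" where
  "Ker_cot k = {M \<in> Ob Crs. zero_object Crs (cot k M)}"


section \<open>Crossed modules and chain complexes as crossed complexes\<close>

record 'a xmod =
  src :: "'a monoid"
  tgt :: "'a monoid"
  xbd :: "'a \<Rightarrow> 'a"
  xact :: "'a \<Rightarrow> 'a \<Rightarrow> 'a"

definition xmod_hom :: "'a xmod \<Rightarrow> 'a xmod \<Rightarrow> (('a \<Rightarrow> 'a) \<times> ('a \<Rightarrow> 'a)) set" where
  "xmod_hom X Y = {(f, g).
     f \<in> hom (src X) (src Y) \<inter> extensional (carrier (src X)) \<and>
     g \<in> hom (tgt X) (tgt Y) \<inter> extensional (carrier (tgt X)) \<and>
     (\<forall>a\<in>carrier (src X). g (xbd X a) = xbd Y (f a)) \<and>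
     (\<forall>b\<in>carrier (tgt X). \<forall>a\<in>carrier (src X). f (xact X b a) = xact Y (g b) (f a))}"

definition XMod :: "('a xmod, ('a \<Rightarrow> 'a) \<times> ('a \<Rightarrow> 'a)) cat" where
  "XMod = \<lparr>Ob = {X. crossed_module (src X) (tgt X) (xbd X) (xact X)}, Hom = xmod_hom,
     Id = (\<lambda>X. (\<lambda>x\<in>carrier (src X). x, \<lambda>x\<in>carrier (tgt X). x)),
     Comp = (\<lambda>X Y Z g f. (compose (carrier (src X)) (fst g) (fst f),
                          compose (carrier (tgt X)) (snd g) (snd f)))\<rparr>"

definition sk1_lev :: "'a xmod \<Rightarrow> nat \<Rightarrow> 'a monoid" where
  "sk1_lev X i =
     (if i = 0 then tgt X else if i = 1 then src X else singleton_group \<one>\<^bsub>src X\<^esub>)"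

definition sk1 :: "('a xmod, ('a \<Rightarrow> 'a) \<times> ('a \<Rightarrow> 'a), 'a crs, nat \<Rightarrow> 'a \<Rightarrow> 'a) cfunctor" where
  "sk1 =
     \<lparr>FOb = (\<lambda>X.
        \<lparr>lev = sk1_lev X,
         bd = (\<lambda>i. if i = 1 then xbd X else (\<lambda>x. \<one>\<^bsub>src X\<^esub>)),
         act = (\<lambda>i b. if i = 1 then xact X b else (\<lambda>x\<in>carrier (sk1_lev X i). x))\<rparr>),
      FHom = (\<lambda>X Y f i.
         if i = 0 then snd f else if i = 1 then fst f
         else (\<lambda>x\<in>carrier (sk1_lev X i). \<one>\<^bsub>src Y\<^esub>))\<rparr>"

record 'a chn =
  clev :: "nat \<Rightarrow> 'a monoid"
  cbd :: "nat \<Rightarrow> 'a \<Rightarrow> 'a"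

definition chain_complex :: "'a chn \<Rightarrow> bool" where
  "chain_complex A \<longleftrightarrow>
     (\<forall>n. comm_group (clev A n)) \<and>
     (\<forall>n\<ge>1. cbd A n \<in> hom (clev A n) (clev A (n - 1))) \<and>
     (\<forall>n\<ge>1. \<forall>x\<in>carrier (clev A (n + 1)). cbd A n (cbd A (n + 1) x) = \<one>\<^bsub>clev A (n - 1)\<^esub>)"

definition chn_hom :: "'a chn \<Rightarrow> 'a chn \<Rightarrow> (nat \<Rightarrow> 'a \<Rightarrow> 'a) set" where
  "chn_hom A B = {f.
     (\<forall>n. f n \<in> hom (clev A n) (clev B n) \<inter> extensional (carrier (clev A n))) \<and>
     (\<forall>n\<ge>1. \<forall>x\<in>carrier (clev A n). f (n - 1) (cbd A n x) = cbd B n (f n x))}"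

definition ChnAb_ge :: "nat \<Rightarrow> ('a chn, nat \<Rightarrow> 'a \<Rightarrow> 'a) cat" where
  "ChnAb_ge k =
     \<lparr>Ob = {A. chain_complex A \<and> (\<forall>i<k. trivial_group (clev A i))}, Hom = chn_hom,
      Id = (\<lambda>A n. \<lambda>x\<in>carrier (clev A n). x),
      Comp = (\<lambda>A B D g f n. compose (carrier (clev A n)) (g n) (f n))\<rparr>"

definition chn_to_crs :: "('a chn, nat \<Rightarrow> 'a \<Rightarrow> 'a, 'a crs, nat \<Rightarrow> 'a \<Rightarrow> 'a) cfunctor" where
  "chn_to_crs =
     \<lparr>FOb = (\<lambda>A. \<lparr>lev = clev A, bd = cbd A, act = (\<lambda>i b. \<lambda>x\<in>carrier (clev A i). x)\<rparr>),
      FHom = (\<lambda>A B f. f)\<rparr>"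


section \<open>Adequacy of the definitions\<close>

text \<open>
  Main results: \<open>category_Crs\<close>; \<open>rep_Mod_iso\<close>; \<open>cot_cc\<close> and \<open>cot_universal\<close> (\<open>cot k M\<close> is
  the reflection of \<open>M\<close> in the \<open>k\<close>-truncated crossed complexes); \<open>sk1_fully_faithful\<close> and
  \<open>essential_image_sk1\<close>; \<open>chn_to_crs_fully_faithful\<close> and \<open>essential_image_chn_to_crs\<close>.
\<close>

lemma carrier_AutoGroup: "carrier (AutoGroup G) = auto G"
  by (simp add: AutoGroup_def)

lemma one_AutoGroup: "\<one>\<^bsub>AutoGroup G\<^esub> = (\<lambda>x\<in>carrier G. x)"
  by (simp add: AutoGroup_def BijGroup_def)

lemma mult_AutoGroup:
  "f \<in> auto G \<Longrightarrow> g \<in> auto G \<Longrightarrow> f \<otimes>\<^bsub>AutoGroup G\<^esub> g = compose (carrier G) f g"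
  by (simp add: AutoGroup_def BijGroup_def auto_def)

lemma trivial_action_hom:
  "group G \<Longrightarrow> (\<lambda>b. \<lambda>x\<in>carrier G. x) \<in> hom H (AutoGroup G)"
  by (rule homI) (simp_all add: carrier_AutoGroup group.id_in_auto mult_AutoGroup fun_eq_iff compose_def)

locale cc = fixes M :: "'a crs" assumes cc: "crossed_complex M"
begin
lemma grp: "group (lev M n)" using cc by (simp add: crossed_complex_def)
lemma comm: "2 \<le> n \<Longrightarrow> comm_group (lev M n)" using cc by (simp add: crossed_complex_def)
lemma bdh: "1 \<le> n \<Longrightarrow> bd M n \<in> hom (lev M n) (lev M (n - 1))" using cc by (simp add: crossed_complex_def)
lemma bdc: "1 \<le> n \<Longrightarrow> x \<in> carrier (lev M n) \<Longrightarrow> bd M n x \<in> carrier (lev M (n - 1))"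
  using bdh hom_in_carrier by metis
lemma bdbd: "1 \<le> n \<Longrightarrow> x \<in> carrier (lev M (n + 1)) \<Longrightarrow> bd M n (bd M (n + 1) x) = \<one>\<^bsub>lev M (n - 1)\<^esub>"
  using cc by (simp add: crossed_complex_def)
lemma proper: "1 \<le> n \<Longrightarrow> bd M n ` carrier (lev M n) \<lhd> lev M (n - 1)"
  using cc by (simp add: crossed_complex_def)
lemma acth: "1 \<le> n \<Longrightarrow> act M n \<in> hom (lev M 0) (AutoGroup (lev M n))"
  using cc by (simp add: crossed_complex_def)
lemma act_auto: "1 \<le> n \<Longrightarrow> b \<in> carrier (lev M 0) \<Longrightarrow> act M n b \<in> auto (lev M n)"
  using acth hom_in_carrier carrier_AutoGroup by metis
lemma act_hom: "1 \<le> n \<Longrightarrow> b \<in> carrier (lev M 0) \<Longrightarrow> act M n b \<in> hom (lev M n) (lev M n)"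
  using act_auto by (auto simp: auto_def)
lemma actc: "1 \<le> n \<Longrightarrow> b \<in> carrier (lev M 0) \<Longrightarrow> x \<in> carrier (lev M n) \<Longrightarrow> act M n b x \<in> carrier (lev M n)"
  using act_hom hom_in_carrier by metis
lemma act_mult: "1 \<le> n \<Longrightarrow> b \<in> carrier (lev M 0) \<Longrightarrow> c \<in> carrier (lev M 0) \<Longrightarrow> x \<in> carrier (lev M n)
   \<Longrightarrow> act M n (b \<otimes>\<^bsub>lev M 0\<^esub> c) x = act M n b (act M n c x)"
  using hom_mult[OF acth] act_auto by (simp add: mult_AutoGroup compose_def)
lemma act_one: "1 \<le> n \<Longrightarrow> x \<in> carrier (lev M n) \<Longrightarrow> act M n \<one>\<^bsub>lev M 0\<^esub> x = x"
proof -
  assume n: "1 \<le> n" "x \<in> carrier (lev M n)"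
  have "act M n \<one>\<^bsub>lev M 0\<^esub> = \<one>\<^bsub>AutoGroup (lev M n)\<^esub>"
    by (intro hom_one acth n grp group.AutoGroup)
  with n show ?thesis by (simp add: one_AutoGroup)
qed
lemma act_bd1: "2 \<le> n \<Longrightarrow> x \<in> carrier (lev M 1) \<Longrightarrow> act M n (bd M 1 x) = \<one>\<^bsub>AutoGroup (lev M n)\<^esub>"
  using cc by (simp add: crossed_complex_def)
lemma equiv: "2 \<le> n \<Longrightarrow> b \<in> carrier (lev M 0) \<Longrightarrow> x \<in> carrier (lev M n) \<Longrightarrow>
   bd M n (act M n b x) = act M (n - 1) b (bd M n x)"
  using cc by (simp add: crossed_complex_def)
lemma cm: "crossed_module (lev M 1) (lev M 0) (bd M 1) (act M 1)"
  using cc by (simp add: crossed_complex_def)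

end

lemma category_Crs: "category Crs"
proof -
  have 1: "(\<lambda>n. \<lambda>x\<in>carrier (lev M n). x) \<in> crs_hom M M" if M: "crossed_complex M" for M :: "'a crs"
  proof -
    interpret cc M using M by (rule cc.intro)
    have "(\<lambda>x\<in>carrier (lev M n). x) \<in> hom (lev M n) (lev M n)" for n
      using grp[of n] group.id_in_auto by (auto simp: auto_def)
    then show ?thesis by (simp add: crs_hom_def bdc actc del: One_nat_def)
  qed
  have 2: "(\<lambda>n. compose (carrier (lev M n)) (g n) (f n)) \<in> crs_hom M P"
    if M: "crossed_complex M" and f: "f \<in> crs_hom M N" and g: "g \<in> crs_hom N P"
    for M N P :: "'a crs" and f g
  proof -
    interpret cc M using M by (rule cc.intro)
    have f': "f n x \<in> carrier (lev N n)" if "x \<in> carrier (lev M n)" for n x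
      using f that by (auto simp: crs_hom_def dest: hom_in_carrier)
    have "compose (carrier (lev M n)) (g n) (f n) \<in> hom (lev M n) (lev P n)" for n
      using grp f g by (intro group.hom_compose) (auto simp: crs_hom_def crossed_complex_def)
    then show ?thesis
      using f g by (auto simp: crs_hom_def compose_def bdc actc f' simp del: One_nat_def)
  qed
  have 3: "compose (carrier (lev M n)) (f n) (\<lambda>x\<in>carrier (lev M n). x) = f n"
    "compose (carrier (lev M n)) (\<lambda>x\<in>carrier (lev N n). x) (f n) = f n"
    if "f \<in> crs_hom M N" for M N :: "'a crs" and f n
  proof -
    have "f n \<in> hom (lev M n) (lev N n)" "f n \<in> extensional (carrier (lev M n))"
      using that by (auto simp: crs_hom_def)
    then show "compose (carrier (lev M n)) (f n) (\<lambda>x\<in>carrier (lev M n). x) = f n"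
      "compose (carrier (lev M n)) (\<lambda>x\<in>carrier (lev N n). x) (f n) = f n"
      by (auto simp: hom_def)
  qed
  have 4: "compose (carrier (lev M n)) (h n) (compose (carrier (lev M n)) (g n) (f n)) =
     compose (carrier (lev M n)) (compose (carrier (lev N n)) (h n) (g n)) (f n)"
    if "f \<in> crs_hom M N" for M N :: "'a crs" and f g h n
    using that by (auto simp: crs_hom_def compose_def fun_eq_iff dest: hom_in_carrier)
  show ?thesis
    unfolding category_def Crs_def
    by (simp add: 1 3) (intro conjI allI impI ballI, (rule 2; assumption), rule ext, rule 4)
qed

context normal begin

lemma rep_in: "x \<in> carrier G \<Longrightarrow> rep (H #> x) \<in> H #> x"
  unfolding rep_def by (rule someI, rule rcos_self) (auto simp: subgroup_axioms)

lemma rcos_rep: "x \<in> carrier G \<Longrightarrow> H #> rep (H #> x) = H #> x"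
  using rep_in repr_independence subgroup_axioms by metis

lemma rep_carrier: "x \<in> carrier G \<Longrightarrow> rep (H #> x) \<in> carrier G"
  using rep_in r_coset_subset_G subset by blast

lemma rep_eq_iff:
  "x \<in> carrier G \<Longrightarrow> y \<in> carrier G \<Longrightarrow> rep (H #> x) = rep (H #> y) \<longleftrightarrow> H #> x = H #> y"
  by (metis rcos_rep)

lemma carrier_rep_Mod: "carrier (rep_Mod G H) = (\<lambda>x. rep (H #> x)) ` carrier G"
  by (auto simp: rep_Mod_def carrier_FactGroup)

lemma rep_Mod_iso: "rep \<in> iso (G Mod H) (rep_Mod G H)"
proof -
  have "inj_on rep (carrier (G Mod H))"
    by (auto simp: inj_on_def carrier_FactGroup rep_eq_iff)
  moreover have "rep \<in> hom (G Mod H) (rep_Mod G H)"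
    by (rule homI) (auto simp: rep_Mod_def carrier_FactGroup rcos_rep)
  ultimately show ?thesis
    by (auto simp: iso_def bij_betw_def rep_Mod_def)
qed

lemma group_rep_Mod: "group (rep_Mod G H)"
proof -
  have "group (rep_Mod G H\<lparr>one := rep \<one>\<^bsub>G Mod H\<^esub>\<rparr>)"
    by (rule group.iso_imp_img_group[OF factorgroup_is_group rep_Mod_iso])
  then show ?thesis by (simp add: rep_Mod_def)
qed

lemma comm_group_rep_Mod: "comm_group G \<Longrightarrow> comm_group (rep_Mod G H)"
proof -
  assume "comm_group G"
  then have "comm_group (G Mod H)"
    by (intro comm_group.abelian_FactGroup subgroup_axioms)
  moreover have "G Mod H \<cong> rep_Mod G H"
    using rep_Mod_iso unfolding is_iso_def by blast
  ultimately show ?thesis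
    using comm_group.iso_imp_comm_group group_rep_Mod group.is_monoid by blast
qed

lemma rep_Mod_carrier: "x \<in> carrier (rep_Mod G H) \<Longrightarrow> x \<in> carrier G"
  by (auto simp: carrier_rep_Mod rep_carrier)

lemma rep_Mod_rep: "x \<in> carrier (rep_Mod G H) \<Longrightarrow> rep (H #> x) = x"
  by (auto simp: carrier_rep_Mod rcos_rep)

lemma rep_in_rep_Mod: "x \<in> carrier G \<Longrightarrow> rep (H #> x) \<in> carrier (rep_Mod G H)"
  by (auto simp: carrier_rep_Mod)

lemma rep_Mod_mult:
  "x \<in> carrier G \<Longrightarrow> y \<in> carrier G \<Longrightarrow>
   rep (H #> x) \<otimes>\<^bsub>rep_Mod G H\<^esub> rep (H #> y) = rep (H #> (x \<otimes> y))"
  by (simp add: rep_Mod_def rcos_rep rcos_sum)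

lemma rep_Mod_mult':
  "x \<in> carrier (rep_Mod G H) \<Longrightarrow> y \<in> carrier (rep_Mod G H) \<Longrightarrow>
   x \<otimes>\<^bsub>rep_Mod G H\<^esub> y = rep (H #> (x \<otimes> y))"
  by (metis rep_Mod_mult rep_Mod_carrier rep_Mod_rep)

lemma rep_Mod_one: "\<one>\<^bsub>rep_Mod G H\<^esub> = rep (H #> \<one>)"
  using subset by (simp add: rep_Mod_def)

lemma rep_hom: "(\<lambda>x. rep (H #> x)) \<in> hom G (rep_Mod G H)"
  by (rule homI) (auto simp: rep_in_rep_Mod rep_Mod_mult)

lemma lift_rep:
  assumes "group K" "h \<in> hom G K" "\<And>x. x \<in> H \<Longrightarrow> h x = \<one>\<^bsub>K\<^esub>" "x \<in> carrier G"
  shows "h (rep (H #> x)) = h x"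
proof -
  interpret h: group_hom G K h
    using assms by (simp add: group_hom_def group_hom_axioms_def is_group)
  obtain z where z: "z \<in> H" "rep (H #> x) = z \<otimes> x"
    using rep_in[OF assms(4)] by (auto simp: r_coset_def)
  then have "z \<in> carrier G" using subset by auto
  with z assms show ?thesis by simp
qed

lemma lift_hom:
  assumes "group K" "h \<in> hom G K" "\<And>x. x \<in> H \<Longrightarrow> h x = \<one>\<^bsub>K\<^esub>"
  shows "h \<in> hom (rep_Mod G H) K"
  using assms(2) by (intro homI)
    (auto simp: rep_Mod_carrier hom_in_carrier rep_Mod_mult' lift_rep[OF assms] hom_mult)

end

lemma hom_AutoGroupI:
  assumes "group A" "group B"
    and 1: "\<And>b. b \<in> carrier B \<Longrightarrow> \<psi> b \<in> hom A A \<inter> extensional (carrier A)"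
    and 2: "\<And>b c a. b \<in> carrier B \<Longrightarrow> c \<in> carrier B \<Longrightarrow> a \<in> carrier A \<Longrightarrow> \<psi> (b \<otimes>\<^bsub>B\<^esub> c) a = \<psi> b (\<psi> c a)"
    and 3: "\<And>a. a \<in> carrier A \<Longrightarrow> \<psi> \<one>\<^bsub>B\<^esub> a = a"
  shows "\<psi> \<in> hom B (AutoGroup A)"
proof -
  interpret B: group B by fact
  have *: "\<psi> b \<in> auto A" if b: "b \<in> carrier B" for b
  proof -
    have "\<psi> b x \<in> carrier A" if "x \<in> carrier A" "b \<in> carrier B" for x b
      using 1 that by (auto dest: hom_in_carrier)
    then have "bij_betw (\<psi> b) (carrier A) (carrier A)"
      using b 2[of "inv\<^bsub>B\<^esub> b" b] 2[of b "inv\<^bsub>B\<^esub> b"] 3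
      by (intro bij_betw_byWitness[where f' = "\<psi> (inv\<^bsub>B\<^esub> b)"]) auto
    then show ?thesis using 1 b by (simp add: auto_def Bij_def)
  qed
  show ?thesis
  proof (rule homI)
    fix b c assume bc: "b \<in> carrier B" "c \<in> carrier B"
    have "\<psi> (b \<otimes>\<^bsub>B\<^esub> c) \<in> extensional (carrier A)" using 1 bc by simp
    then have "\<psi> (b \<otimes>\<^bsub>B\<^esub> c) = compose (carrier A) (\<psi> b) (\<psi> c)"
      by (intro extensionalityI) (use bc 2 in \<open>auto simp: compose_def\<close>)
    then show "\<psi> (b \<otimes>\<^bsub>B\<^esub> c) = \<psi> b \<otimes>\<^bsub>AutoGroup A\<^esub> \<psi> c"
      using bc * by (simp add: mult_AutoGroup)
  qed (simp add: * carrier_AutoGroup)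
qed

context cc begin

lemma im_normal: "bd_image M k \<lhd> lev M k"
  using proper[of "k + 1"] by (simp add: bd_image_def)

sublocale im: normal "bd_image M k" "lev M k" for k by (rule im_normal)

lemma im_act:
  assumes "1 \<le> k" "b \<in> carrier (lev M 0)" "x \<in> bd_image M k"
  shows "act M k b x \<in> bd_image M k"
proof -
  obtain y where y: "y \<in> carrier (lev M (k + 1))" "x = bd M (k + 1) y"
    using assms by (auto simp: bd_image_def)
  have "act M k b x = bd M (k + 1) (act M (k + 1) b y)"
    using equiv[of "k + 1" b y] y assms by simp
  then show ?thesis using actc[of "k + 1" b y] y assms by (auto simp: bd_image_def)
qed

lemma im_bd: "1 \<le> k \<Longrightarrow> x \<in> bd_image M k \<Longrightarrow> bd M k x = \<one>\<^bsub>lev M (k - 1)\<^esub>"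
  using bdbd by (auto simp: bd_image_def)

lemma bd_rep: "1 \<le> k \<Longrightarrow> x \<in> carrier (lev M k) \<Longrightarrow>
  bd M k (rep (bd_image M k #>\<^bsub>lev M k\<^esub> x)) = bd M k x"
  by (rule im.lift_rep[OF grp bdh]) (auto simp: im_bd)

lemma rep_act_rep:
  assumes k: "1 \<le> k" and b: "b \<in> carrier (lev M 0)" and x: "x \<in> carrier (lev M k)"
  shows "rep (bd_image M k #>\<^bsub>lev M k\<^esub> act M k b (rep (bd_image M k #>\<^bsub>lev M k\<^esub> x))) =
     rep (bd_image M k #>\<^bsub>lev M k\<^esub> act M k b x)"
proof -
  have h1: "(\<lambda>x. rep (bd_image M k #>\<^bsub>lev M k\<^esub> x)) \<circ> act M k b \<in> hom (lev M k) (rep_Mod (lev M k) (bd_image M k))"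
    by (rule hom_compose[OF act_hom[OF k b] im.rep_hom])
  have h2: "((\<lambda>x. rep (bd_image M k #>\<^bsub>lev M k\<^esub> x)) \<circ> act M k b) z = \<one>\<^bsub>rep_Mod (lev M k) (bd_image M k)\<^esub>"
    if "z \<in> bd_image M k" for z
    using im_act[OF k b that] im.rcos_const by (simp add: rep_Mod_def)
  from im.lift_rep[OF im.group_rep_Mod h1 h2 x] show ?thesis by simp
qed

lemma cot_lev_carrier: "i \<le> k \<Longrightarrow> x \<in> carrier (cot_lev k M i) \<Longrightarrow> x \<in> carrier (lev M i)"
  using im.rep_Mod_carrier by (auto simp: cot_lev_def split: if_splits)

lemma cot_lev_grp: "group (cot_lev k M n)"
  using grp im.group_rep_Mod by (simp add: cot_lev_def)

lemma cot_act:
  assumes k: "1 \<le> k"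
  shows "(\<lambda>b. \<lambda>x\<in>carrier (cot_lev k M k). rep (bd_image M k #>\<^bsub>lev M k\<^esub> act M k b x))
     \<in> hom (lev M 0) (AutoGroup (cot_lev k M k))"
  (is "?\<psi> \<in> _")
proof -
  have [simp]: "cot_lev k M k = rep_Mod (lev M k) (bd_image M k)" by (simp add: cot_lev_def)
  note C = im.rep_Mod_carrier im.rep_in_rep_Mod actc[OF k]
  show ?thesis
  proof (rule hom_AutoGroupI)
    fix b assume b: "b \<in> carrier (lev M 0)"
    have "rep (bd_image M k #>\<^bsub>lev M k\<^esub> act M k b (x \<otimes>\<^bsub>rep_Mod (lev M k) (bd_image M k)\<^esub> y)) =
       rep (bd_image M k #>\<^bsub>lev M k\<^esub> act M k b x) \<otimes>\<^bsub>rep_Mod (lev M k) (bd_image M k)\<^esub>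
       rep (bd_image M k #>\<^bsub>lev M k\<^esub> act M k b y)"
      if "x \<in> carrier (rep_Mod (lev M k) (bd_image M k))" "y \<in> carrier (rep_Mod (lev M k) (bd_image M k))" for x y
      using that b k C
      by (simp add: im.rep_Mod_mult'[OF that] im.rep_Mod_mult rep_act_rep group.is_monoid monoid.m_closed[OF group.is_monoid[OF grp]] hom_mult[OF act_hom])
    then show "?\<psi> b \<in> hom (cot_lev k M k) (cot_lev k M k) \<inter> extensional (carrier (cot_lev k M k))"
      using b C by (auto intro!: homI simp: monoid.m_closed[OF group.is_monoid[OF im.group_rep_Mod]])
  next
    fix b c x assume "b \<in> carrier (lev M 0)" "c \<in> carrier (lev M 0)" "x \<in> carrier (cot_lev k M k)"
    then show "?\<psi> (b \<otimes>\<^bsub>lev M 0\<^esub> c) x = ?\<psi> b (?\<psi> c x)"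
      using k C by (simp add: act_mult rep_act_rep)
  next
    fix x assume "x \<in> carrier (cot_lev k M k)"
    then show "?\<psi> \<one>\<^bsub>lev M 0\<^esub> x = x"
      using k C by (simp add: act_one im.rep_Mod_rep)
  qed (simp_all add: cot_lev_grp grp im.group_rep_Mod)
qed

lemma cot_lev_simps [simp]:
  "i < k \<Longrightarrow> cot_lev k M i = lev M i"
  "cot_lev k M k = rep_Mod (lev M k) (bd_image M k)"
  "i > k \<Longrightarrow> cot_lev k M i = singleton_group \<one>\<^bsub>lev M i\<^esub>"
  by (simp_all add: cot_lev_def)

lemma cot_cc:
  assumes k: "1 \<le> k"
  shows "crossed_complex (cot k M)"
proof -
  let ?L = "cot_lev k M" and ?D = "bd (cot k M)" and ?A = "act (cot k M)"
  have L: "lev (cot k M) = ?L" by (simp add: cot_def)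
  have k0: "?L 0 = lev M 0" using k by simp
  have D: "?D i = bd M i" if "i \<le> k" for i using that by (simp add: cot_def)
  have D': "?D i x = \<one>\<^bsub>?L (i - 1)\<^esub>" if "i > k" for i x using that by (simp add: cot_def)
  have A1: "?A i = act M i" if "i < k" for i using that by (auto simp: cot_def)
  have A2: "?A k = (\<lambda>b. \<lambda>x\<in>carrier (?L k). rep (bd_image M k #>\<^bsub>lev M k\<^esub> act M k b x))"
    by (auto simp: cot_def)
  have A3: "?A i = (\<lambda>b. \<lambda>x\<in>carrier (?L i). x)" if "i > k" for i using that by (auto simp: cot_def)
  have comm: "comm_group (?L n)" if "2 \<le> n" for n
    using comm[OF that] im.comm_group_rep_Mod by (auto simp: cot_lev_def)
  have Dh: "?D n \<in> hom (?L n) (?L (n - 1))" if n: "1 \<le> n" for n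
  proof -
    consider "n < k" | "n = k" | "n > k" by linarith
    then show ?thesis
    proof cases
      case 1 then show ?thesis using bdh[OF n] D n by simp
    next
      case 2 then show ?thesis using im.lift_hom[OF grp bdh[OF k] im_bd[OF k]] D n by simp
    next
      case 3
      have "?D n = (\<lambda>_. \<one>\<^bsub>?L (n - 1)\<^esub>)" using D'[OF 3] by auto
      then show ?thesis
        using group.is_monoid[OF cot_lev_grp] by (auto intro!: homI simp: monoid.l_one)
    qed
  qed
  have Dc: "?D n x \<in> carrier (?L (n - 1))" if "1 \<le> n" "x \<in> carrier (?L n)" for n x
    using Dh[OF that(1)] that hom_in_carrier by metis
  have DD: "?D n (?D (n + 1) x) = \<one>\<^bsub>?L (n - 1)\<^esub>" if n: "1 \<le> n" and x: "x \<in> carrier (?L (n + 1))" for n x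
  proof (cases "n + 1 \<le> k")
    case True then show ?thesis using bdbd[OF n] cot_lev_carrier x n by (simp add: D)
  next
    case False
    then have "?D (n + 1) x = \<one>\<^bsub>?L n\<^esub>" using D' by simp
    then show ?thesis using hom_one[OF Dh[OF n] cot_lev_grp cot_lev_grp] by simp
  qed
  have Dn: "?D n ` carrier (?L n) \<lhd> ?L (n - 1)" if n: "1 \<le> n" for n
  proof -
    consider "n < k" | "n = k" | "n > k" by linarith
    then show ?thesis
    proof cases
      case 1 then show ?thesis using proper[OF n] D n by simp
    next
      case 2
      have "bd M k ` carrier (?L k) = bd M k ` carrier (lev M k)"
        using bd_rep[OF k] by (auto simp: im.carrier_rep_Mod image_image)
      then show ?thesis using proper[OF n] D n 2 by simp
    next
      case 3
      then have "?D n ` carrier (?L n) = {\<one>\<^bsub>?L (n - 1)\<^esub>}" using D'[OF 3] by (simp add: singleton_group_def)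
      then show ?thesis using group.one_is_normal[OF cot_lev_grp] by metis
    qed
  qed
  have Ah: "?A n \<in> hom (lev M 0) (AutoGroup (?L n))" if n: "1 \<le> n" for n
  proof -
    consider "n < k" | "n = k" | "n > k" by linarith
    then show ?thesis
    proof cases
      case 1 then show ?thesis using acth[OF n] by (simp add: A1)
    next
      case 2 then show ?thesis using cot_act[OF k] A2 by simp
    next
      case 3 then show ?thesis using trivial_action_hom[OF cot_lev_grp] A3 by metis
    qed
  qed
  have L1: "x \<in> carrier (lev M 1)" if "x \<in> carrier (?L 1)" for x
    using that cot_lev_carrier k by blast
  have At: "?A n (?D 1 x) = \<one>\<^bsub>AutoGroup (?L n)\<^esub>" if n: "2 \<le> n" and "x \<in> carrier (?L 1)" for n x
  proof -
    have x: "x \<in> carrier (lev M 1)" using that L1 by blast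
    consider "n < k" | "n = k" | "n > k" by linarith
    then show ?thesis
    proof cases
      case 1 then show ?thesis using act_bd1[OF n x] A1 D k by simp
    next
      case 2
      then show ?thesis using act_bd1[OF n x] k
        by (auto simp: A2 D one_AutoGroup im.rep_Mod_carrier im.rep_Mod_rep intro!: restrict_ext simp del: One_nat_def)
    next
      case 3 then show ?thesis by (simp add: A3 one_AutoGroup)
    qed
  qed
  have Ae: "?D n (?A n b x) = ?A (n - 1) b (?D n x)"
    if n: "2 \<le> n" and b: "b \<in> carrier (lev M 0)" and x: "x \<in> carrier (?L n)" for n b x
  proof -
    consider "n < k" | "n = k" | "n > k" by linarith
    then show ?thesis
    proof cases
      case 1 then show ?thesis using equiv[OF n b] n x by (simp add: A1 D)
    next
      case 2
      have "x \<in> carrier (lev M k)" using x 2 cot_lev_carrier by blast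
      then show ?thesis using equiv[OF n b] n x 2 b k
        by (simp add: A1 A2 D bd_rep actc)
    next
      case 3
      have "?A (n - 1) b \<in> hom (?L (n - 1)) (?L (n - 1))"
        using hom_in_carrier[OF Ah[of "n - 1"] b] n by (simp add: carrier_AutoGroup auto_def)
      then show ?thesis using D'[OF 3] hom_one cot_lev_grp by metis
    qed
  qed
  have "crossed_module (?L 1) (lev M 0) (?D 1) (?A 1)"
  proof (cases "k = 1")
    case False
    then show ?thesis using cm k by (simp add: A1 D del: One_nat_def)
  next
    case True
    note cm = cm[unfolded crossed_module_def]
    interpret G: group "lev M 1" by (rule grp)
    interpret Q: group "rep_Mod (lev M 1) (bd_image M 1)" by (rule im.group_rep_Mod)
    have i: "inv\<^bsub>rep_Mod (lev M 1) (bd_image M 1)\<^esub> a = rep (bd_image M 1 #>\<^bsub>lev M 1\<^esub> inv\<^bsub>lev M 1\<^esub> a)"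
      if "a \<in> carrier (rep_Mod (lev M 1) (bd_image M 1))" for a
      using that im.rep_Mod_mult[of "inv\<^bsub>lev M 1\<^esub> a" 1 a]
      by (intro Q.inv_equality)
        (auto simp: im.rep_Mod_carrier im.rep_Mod_rep im.rep_in_rep_Mod im.rep_Mod_one simp del: One_nat_def)
    have j: "rep (bd_image M 1 #>\<^bsub>lev M 1\<^esub> (a \<otimes>\<^bsub>lev M 1\<^esub> c \<otimes>\<^bsub>lev M 1\<^esub> inv\<^bsub>lev M 1\<^esub> a)) =
       a \<otimes>\<^bsub>rep_Mod (lev M 1) (bd_image M 1)\<^esub> c \<otimes>\<^bsub>rep_Mod (lev M 1) (bd_image M 1)\<^esub> inv\<^bsub>rep_Mod (lev M 1) (bd_image M 1)\<^esub> a"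
      if "a \<in> carrier (rep_Mod (lev M 1) (bd_image M 1))" "c \<in> carrier (rep_Mod (lev M 1) (bd_image M 1))" for a c
      using that
      by (simp add: i im.rep_Mod_mult'[OF that] im.rep_Mod_mult im.rep_Mod_carrier del: One_nat_def)
    have *: "?L 1 = rep_Mod (lev M 1) (bd_image M 1)" "?D 1 = bd M 1" using True D by auto
    have **: "?A 1 b a = rep (bd_image M 1 #>\<^bsub>lev M 1\<^esub> act M 1 b a)" if "a \<in> carrier (?L 1)" for b a
      using that True A2 by simp
    show ?thesis
      unfolding crossed_module_def
    proof (intro conjI ballI)
      fix b a assume "b \<in> carrier (lev M 0)" "a \<in> carrier (?L 1)"
      then show "?D 1 (?A 1 b a) = b \<otimes>\<^bsub>lev M 0\<^esub> ?D 1 a \<otimes>\<^bsub>lev M 0\<^esub> inv\<^bsub>lev M 0\<^esub> b"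
        using cm by (simp add: L1 actc ** bd_rep *(2) del: One_nat_def)
    next
      fix a c assume ac: "a \<in> carrier (?L 1)" "c \<in> carrier (?L 1)"
      then show "?A 1 (?D 1 a) c = a \<otimes>\<^bsub>?L 1\<^esub> c \<otimes>\<^bsub>?L 1\<^esub> inv\<^bsub>?L 1\<^esub> a"
        using cm j[of a c, folded *(1)] by (simp add: L1 ** *(2) del: One_nat_def cot_lev_simps)
    qed (use Dh[of 1] Ah[of 1] k0 cot_lev_grp grp in auto)
  qed
  then show ?thesis
    unfolding crossed_complex_def L k0
    using cot_lev_grp comm Dh DD Dn Ah At Ae by blast
qed
end

lemma trivial_groupD: "trivial_group G \<Longrightarrow> x \<in> carrier G \<Longrightarrow> x = \<one>\<^bsub>G\<^esub>"
  by (auto simp: trivial_group_def)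

lemma one_hom:
  "group H \<Longrightarrow> (\<lambda>x. \<one>\<^bsub>H\<^esub>) \<in> hom G H"
  "group G \<Longrightarrow> group H \<Longrightarrow> (\<lambda>x\<in>carrier G. \<one>\<^bsub>H\<^esub>) \<in> hom G H"
  by (auto intro!: homI simp: group.is_monoid monoid.m_closed[OF group.is_monoid] monoid.l_one[OF group.is_monoid]
      monoid.one_closed[OF group.is_monoid])

lemma crs_homD:
  assumes "f \<in> crs_hom M N"
  shows "f n \<in> hom (lev M n) (lev N n)" "f n \<in> extensional (carrier (lev M n))"
    "x \<in> carrier (lev M n) \<Longrightarrow> f n x \<in> carrier (lev N n)"
    "n \<ge> 1 \<Longrightarrow> x \<in> carrier (lev M n) \<Longrightarrow> f (n - 1) (bd M n x) = bd N n (f n x)"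
    "n \<ge> 1 \<Longrightarrow> b \<in> carrier (lev M 0) \<Longrightarrow> x \<in> carrier (lev M n) \<Longrightarrow>
       f n (act M n b x) = act N n (f 0 b) (f n x)"
  using assms by (auto simp: crs_hom_def dest: hom_in_carrier)

definition cot_unit :: "nat \<Rightarrow> 'a crs \<Rightarrow> nat \<Rightarrow> 'a \<Rightarrow> 'a" where
  "cot_unit k M i = (\<lambda>x\<in>carrier (lev M i).
     if i < k then x else if i = k then rep (bd_image M k #>\<^bsub>lev M k\<^esub> x) else \<one>\<^bsub>lev M i\<^esub>)"

context cc
begin

lemma cot_Crs_le: "1 \<le> k \<Longrightarrow> cot k M \<in> Crs_le k"
proof -
  assume "1 \<le> k"
  moreover have "trivial_group (singleton_group e)" for e :: 'a
    by (simp add: trivial_group_def) (simp add: singleton_group_def)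
  ultimately show ?thesis
    using cot_cc by (auto simp: Crs_le_def Crs_def cot_def)
qed

lemma cot_unit_hom:
  assumes k: "1 \<le> k"
  shows "cot_unit k M \<in> crs_hom M (cot k M)"
proof -
  have L: "lev (cot k M) = cot_lev k M" by (simp add: cot_def)
  have h: "cot_unit k M n \<in> hom (lev M n) (cot_lev k M n)" for n
  proof -
    consider "n < k" | "n = k" | "n > k" by linarith
    then show ?thesis
    proof cases
      case 1
      then have "cot_unit k M n = (\<lambda>x\<in>carrier (lev M n). x)" by (simp add: cot_unit_def)
      then show ?thesis using 1 group.id_in_auto[OF grp] by (simp add: auto_def)
    next
      case 2
      then show ?thesis using im.rep_hom[of k] monoid.m_closed[OF group.is_monoid[OF grp]]
        by (auto intro!: homI simp: cot_unit_def im.rep_in_rep_Mod im.rep_Mod_mult)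
    next
      case 3
      then have "cot_unit k M n = (\<lambda>x\<in>carrier (lev M n). \<one>\<^bsub>cot_lev k M n\<^esub>)"
        by (simp add: cot_unit_def singleton_group_def)
      then show ?thesis using one_hom(2)[OF grp cot_lev_grp] by metis
    qed
  qed
  have d: "cot_unit k M (n - 1) (bd M n x) = bd (cot k M) n (cot_unit k M n x)"
    if n: "1 \<le> n" and x: "x \<in> carrier (lev M n)" for n x
  proof -
    consider "n < k" | "n = k" | "n = k + 1" | "n > k + 1" by linarith
    then show ?thesis
    proof cases
      case 3
      then have "bd M n x \<in> bd_image M k" using x by (auto simp: bd_image_def)
      then show ?thesis using 3 bdc[OF n x]
        by (simp add: cot_unit_def cot_def im.rcos_const[OF grp] rep_Mod_def)
    next
      case 1
      then have "n - 1 < k" by linarith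
      with 1 show ?thesis using x bdc[OF n x] by (simp add: cot_unit_def cot_def)
    next
      case 2
      then have "n - 1 < k" using k by linarith
      with 2 show ?thesis using x bdc[OF n x] k by (simp add: cot_unit_def cot_def bd_rep)
    next
      case 4
      then have "n - 1 > k" by linarith
      with 4 show ?thesis using x bdc[OF n x] by (simp add: cot_unit_def cot_def singleton_group_def)
    qed
  qed
  have a: "cot_unit k M n (act M n b x) = act (cot k M) n (cot_unit k M 0 b) (cot_unit k M n x)"
    if n: "1 \<le> n" and b: "b \<in> carrier (lev M 0)" and x: "x \<in> carrier (lev M n)" for n b x
  proof -
    have e: "cot_unit k M 0 b = b" "act M n b x \<in> carrier (lev M n)"
      using k b actc[OF n b x] by (simp_all add: cot_unit_def)
    have e': "rep (bd_image M k #>\<^bsub>lev M k\<^esub> x) \<in> carrier (rep_Mod (lev M k) (bd_image M k))" if "n = k"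
      using im.rep_in_rep_Mod x that by simp
    consider "n < k" | "n = k" | "n > k" by linarith
    then show ?thesis
    proof cases
      case 1 then show ?thesis using e x by (simp add: cot_unit_def cot_def)
    next
      case 2 then show ?thesis using e e' x b k by (simp add: cot_unit_def cot_def rep_act_rep)
    next
      case 3 then show ?thesis using e x by (simp add: cot_unit_def cot_def singleton_group_def)
    qed
  qed
  show ?thesis
    unfolding crs_hom_def L using h d a by (simp add: cot_unit_def)
qed

lemma cot_universal:
  assumes k: "1 \<le> k" and N: "N \<in> Crs_le k" and f: "f \<in> crs_hom M N"
  shows "\<exists>!g. g \<in> crs_hom (cot k M) N \<and> Comp Crs M (cot k M) N g (cot_unit k M) = f"
proof -
  have "crossed_complex N" using N by (simp add: Crs_le_def Crs_def)
  then interpret N: cc N by (rule cc.intro)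
  have Nt: "trivial_group (lev N i)" if "i > k" for i using N that by (simp add: Crs_le_def)
  have L: "lev (cot k M) = cot_lev k M" by (simp add: cot_def)
  define g where "g i = (if i > k then (\<lambda>x\<in>carrier (cot_lev k M i). \<one>\<^bsub>lev N i\<^esub>)
     else restrict (f i) (carrier (cot_lev k M i)))" for i
  have fh: "f i x = \<one>\<^bsub>lev N i\<^esub>" if "i > k" "x \<in> carrier (lev M i)" for i x
    using trivial_groupD[OF Nt[OF that(1)] crs_homD(3)[OF f that(2)]] .
  have fim: "f k x = \<one>\<^bsub>lev N k\<^esub>" if x: "x \<in> bd_image M k" for x
  proof -
    obtain y where y: "y \<in> carrier (lev M (k + 1))" "x = bd M (k + 1) y"
      using x unfolding bd_image_def by blast
    have "f (k + 1 - 1) (bd M (k + 1) y) = bd N (k + 1) (f (k + 1) y)"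
      by (rule crs_homD(4)[OF f _ y(1)]) simp
    also have "f (k + 1) y = \<one>\<^bsub>lev N (k + 1)\<^esub>" by (rule fh[OF _ y(1)]) simp
    also have "bd N (k + 1) \<one>\<^bsub>lev N (k + 1)\<^esub> = \<one>\<^bsub>lev N (k + 1 - 1)\<^esub>"
      by (rule hom_one[OF N.bdh N.grp N.grp]) simp
    finally have "f k (bd M (k + 1) y) = \<one>\<^bsub>lev N k\<^esub>" by (simp only: add_diff_cancel_right')
    then show ?thesis by (simp only: y(2))
  qed
  have frep: "f k (rep (bd_image M k #>\<^bsub>lev M k\<^esub> x)) = f k x" if "x \<in> carrier (lev M k)" for x
    by (rule im.lift_rep[OF N.grp crs_homD(1)[OF f] fim that])
  have h: "g n \<in> hom (cot_lev k M n) (lev N n)" for n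
  proof -
    have *: "restrict u (carrier G) \<in> hom G H" if "group G" "u \<in> hom G H" for G H :: "'a monoid" and u
      using that by (auto intro!: homI simp: hom_in_carrier hom_mult monoid.m_closed[OF group.is_monoid])
    consider "n < k" | "n = k" | "n > k" by linarith
    then show ?thesis
    proof cases
      case 1 then show ?thesis using *[OF grp crs_homD(1)[OF f]] by (simp add: g_def)
    next
      case 2
      have "f k \<in> hom (cot_lev k M k) (lev N k)"
        using im.lift_hom[OF N.grp crs_homD(1)[OF f] fim] by simp
      from *[OF cot_lev_grp this] show ?thesis using 2 by (simp add: g_def)
    next
      case 3 then show ?thesis using one_hom(2)[OF cot_lev_grp[of k n] N.grp[of n]] by (simp add: g_def)
    qed
  qed
  have g: "g n x = f n x" if "n \<le> k" "x \<in> carrier (cot_lev k M n)" for n x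
    using that by (simp add: g_def)
  have g1: "g n x = \<one>\<^bsub>lev N n\<^esub>" if "n > k" "x \<in> carrier (cot_lev k M n)" for n x
    using that by (simp add: g_def)
  interpret C: cc "cot k M" using cot_cc[OF k] by (rule cc.intro)
  have d: "g (n - 1) (bd (cot k M) n x) = bd N n (g n x)"
    if n: "1 \<le> n" and x: "x \<in> carrier (cot_lev k M n)" for n x
  proof (cases "n \<le> k")
    case True
    have "bd (cot k M) n x \<in> carrier (cot_lev k M (n - 1))" using C.bdc[OF n] x L by simp
    moreover have "bd (cot k M) n x = bd M n x" using True by (simp add: cot_def)
    moreover have "n - 1 \<le> k" using True by simp
    ultimately have "g (n - 1) (bd (cot k M) n x) = f (n - 1) (bd M n x)" using g by metis
    also have "\<dots> = bd N n (f n x)" by (rule crs_homD(4)[OF f n cot_lev_carrier[OF True x]])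
    finally show ?thesis using g[OF True x] by simp
  next
    case False
    then have "bd (cot k M) n x = \<one>\<^bsub>cot_lev k M (n - 1)\<^esub>" by (simp add: cot_def)
    then have "g (n - 1) (bd (cot k M) n x) = \<one>\<^bsub>lev N (n - 1)\<^esub>"
      using hom_one[OF h cot_lev_grp N.grp] by metis
    moreover have "g n x = \<one>\<^bsub>lev N n\<^esub>" using False g1 x by simp
    ultimately show ?thesis using hom_one[OF N.bdh[OF n] N.grp N.grp] by metis
  qed
  have a: "g n (act (cot k M) n b x) = act N n (g 0 b) (g n x)"
    if n: "1 \<le> n" and b: "b \<in> carrier (lev M 0)" and x: "x \<in> carrier (cot_lev k M n)" for n b x
  proof -
    have g0: "g 0 b = f 0 b" using b k by (simp add: g_def)
    have c: "act (cot k M) n b x \<in> carrier (cot_lev k M n)"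
      using C.actc[OF n, of b x] b x k L by simp
    have m: "n \<le> k \<Longrightarrow> x \<in> carrier (lev M n)" using cot_lev_carrier x by blast
    consider "n < k" | "n = k" | "n > k" by linarith
    then show ?thesis
    proof cases
      case 1
      then show ?thesis using g[OF _ c] g[OF _ x] g0 crs_homD(5)[OF f n b m] by (simp add: cot_def)
    next
      case 2
      then have "act (cot k M) n b x = rep (bd_image M k #>\<^bsub>lev M k\<^esub> act M k b x)"
        using x by (simp add: cot_def)
      then show ?thesis using 2 g[OF _ c] g[OF _ x] g0 crs_homD(5)[OF f n b m] frep[OF actc[OF k b]] m by simp
    next
      case 3
      have "act N n (f 0 b) \<one>\<^bsub>lev N n\<^esub> = \<one>\<^bsub>lev N n\<^esub>"
        using hom_one[OF N.act_hom[OF n] N.grp N.grp] crs_homD(3)[OF f b] by blast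
      then show ?thesis using g1[OF 3 c] g1[OF 3 x] g0 by simp
    qed
  qed
  have gh: "g \<in> crs_hom (cot k M) N"
    unfolding crs_hom_def L using h d a k by (simp add: g_def)
  have unit: "cot_unit k M i x \<in> carrier (cot_lev k M i)" if "x \<in> carrier (lev M i)" for i x
    using crs_homD(3)[OF cot_unit_hom[OF k] that] L by simp
  have fac: "compose (carrier (lev M i)) (g i) (cot_unit k M i) = f i" for i
  proof (rule extensionalityI)
    show "compose (carrier (lev M i)) (g i) (cot_unit k M i) \<in> extensional (carrier (lev M i))" by simp
    show "f i \<in> extensional (carrier (lev M i))" using crs_homD(2)[OF f] .
    fix x assume x: "x \<in> carrier (lev M i)"
    consider "i < k" | "i = k" | "i > k" by linarith
    then show "compose (carrier (lev M i)) (g i) (cot_unit k M i) x = f i x"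
    proof cases
      case 1 then show ?thesis using x g[OF _ unit[OF x]] by (simp add: compose_def cot_unit_def)
    next
      case 2 then show ?thesis using x g[OF _ unit[OF x]] by (simp add: compose_def cot_unit_def frep)
    next
      case 3 then show ?thesis using x g1[OF _ unit[OF x]] by (simp add: compose_def fh)
    qed
  qed
  have surj: "\<exists>y\<in>carrier (lev M i). cot_unit k M i y = x" if "x \<in> carrier (cot_lev k M i)" for i x
  proof -
    consider "i < k" | "i = k" | "i > k" by linarith
    then show ?thesis
    proof cases
      case 3
      have "\<one>\<^bsub>lev M i\<^esub> \<in> carrier (lev M i)" by (rule monoid.one_closed[OF group.is_monoid[OF grp]])
      moreover have "x = \<one>\<^bsub>lev M i\<^esub>" using that 3 by (simp add: singleton_group_def)
      ultimately show ?thesis using 3 by (auto simp: cot_unit_def)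
    qed (use that in \<open>auto simp: cot_unit_def im.carrier_rep_Mod\<close>)
  qed
  show ?thesis
  proof (intro ex1I conjI)
    show "g \<in> crs_hom (cot k M) N" by (rule gh)
    show "Comp Crs M (cot k M) N g (cot_unit k M) = f" using fac by (simp add: Crs_def)
    fix g' assume g': "g' \<in> crs_hom (cot k M) N \<and> Comp Crs M (cot k M) N g' (cot_unit k M) = f"
    show "g' = g"
    proof (rule ext, rule extensionalityI)
      fix i
      show "g' i \<in> extensional (carrier (cot_lev k M i))" "g i \<in> extensional (carrier (cot_lev k M i))"
        using g' gh crs_homD(2) L by metis+
      fix x assume "x \<in> carrier (cot_lev k M i)"
      then obtain y where y: "y \<in> carrier (lev M i)" "cot_unit k M i y = x" using surj by blast
      have "compose (carrier (lev M i)) (g' i) (cot_unit k M i) = f i"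
        using g' by (auto simp: Crs_def)
      then have "compose (carrier (lev M i)) (g' i) (cot_unit k M i) y = compose (carrier (lev M i)) (g i) (cot_unit k M i) y"
        using fac by simp
      then show "g' i x = g i x" using y by (simp add: compose_def)
    qed
  qed
qed

end

lemma trivial_singleton: "trivial_group (singleton_group e)"
  by (simp add: trivial_group_def) (simp add: singleton_group_def)

lemma normal_one_image:
  "group G \<Longrightarrow> trivial_group H \<Longrightarrow> d \<in> hom H G \<Longrightarrow> d ` carrier H \<lhd> G"
proof -
  assume a: "group G" "trivial_group H" "d \<in> hom H G"
  then have "d ` carrier H = {\<one>\<^bsub>G\<^esub>}"
    using hom_one[of d H G] by (simp add: trivial_group_def)
  then show ?thesis using group.one_is_normal a by metis
qed

lemma comm_group_normal: "comm_group G \<Longrightarrow> group H \<Longrightarrow> d \<in> hom H G \<Longrightarrow> d ` carrier H \<lhd> G"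
proof -
  assume a: "comm_group G" "group H" "d \<in> hom H G"
  then have "group G" by (simp add: comm_group_def)
  then interpret group_hom H G d using a by (simp add: group_hom_def group_hom_axioms_def)
  show ?thesis by (rule comm_group.subgroup_imp_normal[OF a(1) img_is_subgroup])
qed

lemma crossed_module_normal: "crossed_module A B d \<phi> \<Longrightarrow> d ` carrier A \<lhd> B"
proof -
  assume cm: "crossed_module A B d \<phi>"
  then interpret A: group A by (simp add: crossed_module_def)
  interpret B: group B using cm by (simp add: crossed_module_def)
  interpret group_hom A B d using cm by (simp add: crossed_module_def group_hom_def group_hom_axioms_def)
  show ?thesis
  proof (rule B.normal_invI[OF img_is_subgroup])
    fix b h assume b: "b \<in> carrier B" and "h \<in> d ` carrier A"
    then obtain a where a: "a \<in> carrier A" "h = d a" by blast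
    have "\<phi> b \<in> auto A" using cm b carrier_AutoGroup by (metis crossed_module_def hom_in_carrier)
    then have "\<phi> b a \<in> carrier A" using a by (auto simp: auto_def dest: hom_in_carrier)
    moreover have "b \<otimes>\<^bsub>B\<^esub> h \<otimes>\<^bsub>B\<^esub> inv\<^bsub>B\<^esub> b = d (\<phi> b a)" using cm a b by (simp add: crossed_module_def)
    ultimately show "b \<otimes>\<^bsub>B\<^esub> h \<otimes>\<^bsub>B\<^esub> inv\<^bsub>B\<^esub> b \<in> d ` carrier A" by simp
  qed
qed

lemma ge_2_iff: "(2::nat) \<le> n \<longleftrightarrow> n \<noteq> 0 \<and> n \<noteq> 1" by auto

lemma sk1_Crs_le:
  assumes X: "X \<in> Ob XMod"
  shows "FOb sk1 X \<in> Crs_le 1"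
proof -
  have cm: "crossed_module (src X) (tgt X) (xbd X) (xact X)" using X by (simp add: XMod_def)
  note c = cm[unfolded crossed_module_def]
  let ?M = "FOb sk1 X"
  have L: "lev ?M = sk1_lev X" by (simp add: sk1_def)
  have L0: "sk1_lev X 0 = tgt X" "sk1_lev X 1 = src X" by (simp_all add: sk1_lev_def)
  have L2: "sk1_lev X n = singleton_group \<one>\<^bsub>src X\<^esub>" if "2 \<le> n" for n using that by (simp add: sk1_lev_def)
  have D1: "bd ?M 1 = xbd X" "act ?M 1 = xact X" by (auto simp: sk1_def)
  have D2: "bd ?M n = (\<lambda>x. \<one>\<^bsub>src X\<^esub>)" "act ?M n = (\<lambda>b. \<lambda>x\<in>carrier (sk1_lev X n). x)" if "2 \<le> n" for n
    using that by (auto simp: sk1_def)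
  have g: "group (sk1_lev X n)" for n using c by (simp add: sk1_lev_def)
  have comm: "comm_group (sk1_lev X n)" if "2 \<le> n" for n using that by (simp add: L2)
  have t: "trivial_group (sk1_lev X n)" if "2 \<le> n" for n using that trivial_singleton by (simp add: L2)
  have one: "\<one>\<^bsub>sk1_lev X n\<^esub> = \<one>\<^bsub>src X\<^esub>" if "1 \<le> n" for n
    using that by (simp add: sk1_lev_def singleton_group_def)
  have Dh: "bd ?M n \<in> hom (sk1_lev X n) (sk1_lev X (n - 1))" if n: "1 \<le> n" for n
  proof (cases "n = 1")
    case True then show ?thesis using c L0 D1 by simp
  next
    case False
    then have "2 \<le> n" using n by simp
    then show ?thesis using one_hom(1)[OF g[of "n - 1"]] one[of "n - 1"] by (simp add: D2)
  qed
  have Ah: "act ?M n \<in> hom (tgt X) (AutoGroup (sk1_lev X n))" if n: "1 \<le> n" for n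
  proof (cases "n = 1")
    case True then show ?thesis using c L0 D1 by simp
  next
    case False
    then have "2 \<le> n" using n by simp
    then show ?thesis unfolding D2(2)[OF \<open>2 \<le> n\<close>] by (intro trivial_action_hom g)
  qed
  have DD: "bd ?M n (bd ?M (n + 1) x) = \<one>\<^bsub>sk1_lev X (n - 1)\<^esub>" if n: "1 \<le> n" for n x
  proof -
    have "bd ?M (n + 1) x = \<one>\<^bsub>sk1_lev X n\<^esub>" using n one by (simp add: D2)
    then show ?thesis using hom_one[OF Dh[OF n] g g] by metis
  qed
  have Dn: "bd ?M n ` carrier (sk1_lev X n) \<lhd> sk1_lev X (n - 1)" if n: "1 \<le> n" for n
  proof (cases "n = 1")
    case True then show ?thesis using crossed_module_normal[OF cm] L0 D1 by simp
  next
    case False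
    then have "2 \<le> n" using n by simp
    then show ?thesis using normal_one_image[OF g t Dh[OF n]] by simp
  qed
  have At: "act ?M n (bd ?M 1 x) = \<one>\<^bsub>AutoGroup (sk1_lev X n)\<^esub>" if "2 \<le> n" for n x
    using that by (simp add: D2 one_AutoGroup)
  have Ae: "bd ?M n (act ?M n b x) = act ?M (n - 1) b (bd ?M n x)" if n: "2 \<le> n" and b: "b \<in> carrier (tgt X)" for n b x
  proof -
    have "n - 1 \<ge> 1" using n by simp
    then have "act ?M (n - 1) b \<in> hom (sk1_lev X (n - 1)) (sk1_lev X (n - 1))"
      using hom_in_carrier[OF Ah[of "n - 1"] b] by (simp add: carrier_AutoGroup auto_def)
    then have "act ?M (n - 1) b \<one>\<^bsub>src X\<^esub> = \<one>\<^bsub>src X\<^esub>" using hom_one g one[OF \<open>n - 1 \<ge> 1\<close>] by metis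
    then show ?thesis by (simp add: D2[OF n])
  qed
  have "crossed_complex ?M"
    unfolding crossed_complex_def L L0 D1 using g comm Dh DD Dn Ah At Ae cm unfolding D1 by blast
  then show ?thesis
    using t by (simp add: Crs_le_def L Crs_def)
qed

lemma sk1_ext:
  assumes Y: "Y \<in> Ob XMod" and f: "f \<in> crs_hom (FOb sk1 X) (FOb sk1 Y)"
  shows "FHom sk1 X Y (f 1, f 0) = f"
proof -
  have "f i = (\<lambda>x\<in>carrier (sk1_lev X i). \<one>\<^bsub>src Y\<^esub>)" if "2 \<le> i" for i
  proof (rule extensionalityI)
    show "f i \<in> extensional (carrier (sk1_lev X i))" using crs_homD(2)[OF f, of i] by (simp add: sk1_def)
    fix x assume "x \<in> carrier (sk1_lev X i)"
    then have "f i x \<in> carrier (sk1_lev Y i)" using crs_homD(3)[OF f, of x i] by (simp add: sk1_def)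
    then show "f i x = (\<lambda>x\<in>carrier (sk1_lev X i). \<one>\<^bsub>src Y\<^esub>) x"
      using that \<open>x \<in> _\<close> by (simp add: sk1_lev_def singleton_group_def)
  qed simp
  then show ?thesis by (auto simp: sk1_def fun_eq_iff ge_2_iff)
qed

lemma sk1_hom:
  assumes X: "X \<in> Ob XMod" and Y: "Y \<in> Ob XMod" and f: "f \<in> xmod_hom X Y"
  shows "FHom sk1 X Y f \<in> crs_hom (FOb sk1 X) (FOb sk1 Y)"
proof -
  obtain f1 f0 where ff: "f = (f1, f0)" by force
  have cX: "crossed_module (src X) (tgt X) (xbd X) (xact X)" using X by (simp add: XMod_def)
  have cY: "crossed_module (src Y) (tgt Y) (xbd Y) (xact Y)" using Y by (simp add: XMod_def)
  have h: "f1 \<in> hom (src X) (src Y)" "f0 \<in> hom (tgt X) (tgt Y)"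
    "f1 \<in> extensional (carrier (src X))" "f0 \<in> extensional (carrier (tgt X))"
    "\<And>a. a \<in> carrier (src X) \<Longrightarrow> f0 (xbd X a) = xbd Y (f1 a)"
    "\<And>b a. b \<in> carrier (tgt X) \<Longrightarrow> a \<in> carrier (src X) \<Longrightarrow> f1 (xact X b a) = xact Y (f0 b) (f1 a)"
    using f by (auto simp: ff xmod_hom_def)
  let ?f = "FHom sk1 X Y f"
  have o: "f1 \<one>\<^bsub>src X\<^esub> = \<one>\<^bsub>src Y\<^esub>" using hom_one[OF h(1)] cX cY by (simp add: crossed_module_def)
  have h2: "(\<lambda>x\<in>{\<one>\<^bsub>src X\<^esub>}. \<one>\<^bsub>src Y\<^esub>) \<in> hom (singleton_group \<one>\<^bsub>src X\<^esub>) (singleton_group \<one>\<^bsub>src Y\<^esub>)"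
    by (auto simp: hom_def singleton_group_def)
  have A: "?f n \<in> hom (sk1_lev X n) (sk1_lev Y n) \<inter> extensional (carrier (sk1_lev X n))" for n
    using h h2 by (auto simp: sk1_def sk1_lev_def ff)
  have B: "?f (n - 1) (bd (FOb sk1 X) n x) = bd (FOb sk1 Y) n (?f n x)"
    if n: "1 \<le> n" and x: "x \<in> carrier (sk1_lev X n)" for n x
  proof -
    consider "n = 1" | "n = 2" | "n > 2" using n by linarith
    then show ?thesis
      by cases (use h o x in \<open>simp_all add: sk1_def sk1_lev_def ff\<close>)
  qed
  have C: "?f n (act (FOb sk1 X) n b x) = act (FOb sk1 Y) n (?f 0 b) (?f n x)"
    if n: "1 \<le> n" and b: "b \<in> carrier (tgt X)" and x: "x \<in> carrier (sk1_lev X n)" for n b x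
    using n b x h by (auto simp: sk1_def sk1_lev_def ff singleton_group_def)
  show ?thesis
    using A B C by (simp add: crs_hom_def) (simp add: sk1_def sk1_lev_def)
qed

lemma sk1_fully_faithful: "fully_faithful XMod Crs sk1"
proof -
  have Ob: "FOb sk1 X \<in> Ob Crs" if "X \<in> Ob XMod" for X :: "'a xmod"
    using sk1_Crs_le[OF that] by (simp add: Crs_le_def)
  have surj: "(f 1, f 0) \<in> xmod_hom X Y"
    if "X \<in> Ob XMod" "Y \<in> Ob XMod" and f: "f \<in> crs_hom (FOb sk1 X) (FOb sk1 Y)" for X Y :: "'a xmod" and f
    using crs_homD(1,2)[OF f, of 0] crs_homD(1,2)[OF f, of 1] crs_homD(4,5)[OF f, of 1]
    by (auto simp: xmod_hom_def sk1_def sk1_lev_def)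
  have inj: "f = g" if "FHom sk1 X Y f = FHom sk1 X Y g" for X Y :: "'a xmod" and f g
  proof -
    have "FHom sk1 X Y f 0 = FHom sk1 X Y g 0" "FHom sk1 X Y f 1 = FHom sk1 X Y g 1" using that by auto
    then show ?thesis by (auto simp: sk1_def prod_eq_iff)
  qed
  have bij: "bij_betw (FHom sk1 X Y) (xmod_hom X Y) (crs_hom (FOb sk1 X) (FOb sk1 Y))"
    if "X \<in> Ob XMod" "Y \<in> Ob XMod" for X Y :: "'a xmod"
  proof (rule bij_betw_imageI)
    show "inj_on (FHom sk1 X Y) (xmod_hom X Y)" using inj by (meson inj_onI)
    have "f \<in> FHom sk1 X Y ` xmod_hom X Y" if "f \<in> crs_hom (FOb sk1 X) (FOb sk1 Y)" for f
      using sk1_ext[OF \<open>Y \<in> _\<close> that] surj[OF \<open>X \<in> _\<close> \<open>Y \<in> _\<close> that] by (metis image_eqI)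
    then show "FHom sk1 X Y ` xmod_hom X Y = crs_hom (FOb sk1 X) (FOb sk1 Y)"
      using sk1_hom[OF that] by blast
  qed
  have id: "FHom sk1 X X (Id XMod X) = Id Crs (FOb sk1 X)" for X :: "'a xmod"
    by (rule ext) (auto simp: sk1_def XMod_def Crs_def sk1_lev_def singleton_group_def)
  have comp: "FHom sk1 X Z (Comp XMod X Y Z g f) =
      Comp Crs (FOb sk1 X) (FOb sk1 Y) (FOb sk1 Z) (FHom sk1 Y Z g) (FHom sk1 X Y f)" for X Y Z :: "'a xmod" and f g
    by (rule ext) (auto simp: sk1_def XMod_def Crs_def sk1_lev_def singleton_group_def compose_def)
  show ?thesis
    unfolding fully_faithful_def is_functor_def
    using Ob bij id comp sk1_hom by (auto simp: XMod_def Crs_def)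
qed

lemma crs_iso_trivial:
  assumes "crossed_complex M" "crossed_complex N"
    and "\<And>i. i \<in> S \<Longrightarrow> lev N i = lev M i"
    and "\<And>i. i \<notin> S \<Longrightarrow> trivial_group (lev M i) \<and> trivial_group (lev N i)"
    and "\<And>i x. i \<in> S \<Longrightarrow> i \<ge> 1 \<Longrightarrow> i - 1 \<in> S \<Longrightarrow> x \<in> carrier (lev M i) \<Longrightarrow> bd N i x = bd M i x"
    and "\<And>i b x. i \<in> S \<Longrightarrow> i \<ge> 1 \<Longrightarrow> b \<in> carrier (lev M 0) \<Longrightarrow> x \<in> carrier (lev M i) \<Longrightarrow>
       act N i (if 0 \<in> S then b else \<one>\<^bsub>lev N 0\<^esub>) x = act M i b x"
  shows "(\<lambda>i. \<lambda>x\<in>carrier (lev M i). if i \<in> S then x else \<one>\<^bsub>lev N i\<^esub>) \<in> crs_hom M N"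
proof -
  interpret M: cc M by (rule cc.intro) fact
  interpret N: cc N by (rule cc.intro) fact
  let ?f = "\<lambda>i. \<lambda>x\<in>carrier (lev M i). if i \<in> S then x else \<one>\<^bsub>lev N i\<^esub>"
  have h: "?f i \<in> hom (lev M i) (lev N i)" for i
  proof (cases "i \<in> S")
    case True
    then show ?thesis using group.id_in_auto[OF M.grp[of i]] assms(3)[OF True] by (simp add: auto_def)
  next
    case False
    then show ?thesis using one_hom(2)[OF M.grp[of i] N.grp[of i]] by simp
  qed
  have c: "?f i x \<in> carrier (lev N i)" if "x \<in> carrier (lev M i)" for i x
    using hom_in_carrier[OF h that] .
  have d: "?f (n - 1) (bd M n x) = bd N n (?f n x)" if n: "1 \<le> n" and x: "x \<in> carrier (lev M n)" for n x
  proof (cases "n - 1 \<in> S")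
    case False
    have "bd N n (?f n x) \<in> carrier (lev N (n - 1))" "?f (n - 1) (bd M n x) \<in> carrier (lev N (n - 1))"
      using N.bdc[OF n c[OF x]] c[OF M.bdc[OF n x]] by auto
    then show ?thesis using assms(4)[OF False] trivial_groupD by metis
  next
    case True
    note T = True
    show ?thesis
    proof (cases "n \<in> S")
      case True
      then show ?thesis using T x M.bdc[OF n x] assms(5)[OF True n T x] by simp
    next
      case False
      then have "x = \<one>\<^bsub>lev M n\<^esub>" using assms(4) x trivial_groupD by metis
      then have "bd M n x = \<one>\<^bsub>lev M (n - 1)\<^esub>" using hom_one[OF M.bdh[OF n] M.grp M.grp] by simp
      moreover have "?f n x = \<one>\<^bsub>lev N n\<^esub>" using False x by simp
      moreover have "bd N n \<one>\<^bsub>lev N n\<^esub> = \<one>\<^bsub>lev N (n - 1)\<^esub>" using hom_one[OF N.bdh[OF n] N.grp N.grp] .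
      moreover have "?f (n - 1) \<one>\<^bsub>lev M (n - 1)\<^esub> = \<one>\<^bsub>lev N (n - 1)\<^esub>" by (rule hom_one[OF h M.grp N.grp])
      ultimately show ?thesis by metis
    qed
  qed
  have a: "?f n (act M n b x) = act N n (?f 0 b) (?f n x)"
    if n: "1 \<le> n" and b: "b \<in> carrier (lev M 0)" and x: "x \<in> carrier (lev M n)" for n b x
  proof (cases "n \<in> S")
    case True
    then show ?thesis using assms(6)[OF True n b x] M.actc[OF n b x] b x by simp
  next
    case False
    have "?f n (act M n b x) \<in> carrier (lev N n)" "act N n (?f 0 b) (?f n x) \<in> carrier (lev N n)"
      using c[OF M.actc[OF n b x]] N.actc[OF n c[OF b] c[OF x]] by auto
    then show ?thesis using assms(4)[OF False] trivial_groupD by metis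
  qed
  show ?thesis unfolding crs_hom_def
    by (intro CollectI conjI allI impI ballI IntI restrict_extensional h d a)
qed

lemma crs_isomorphicI:
  assumes M: "crossed_complex M" and N: "crossed_complex N"
    and 1: "\<And>i. i \<in> S \<Longrightarrow> lev N i = lev M i"
    and 2: "\<And>i. i \<notin> S \<Longrightarrow> trivial_group (lev M i) \<and> trivial_group (lev N i)"
    and 3: "\<And>i x. i \<in> S \<Longrightarrow> i \<ge> 1 \<Longrightarrow> i - 1 \<in> S \<Longrightarrow> x \<in> carrier (lev M i) \<Longrightarrow> bd N i x = bd M i x"
    and 4: "\<And>i b x. i \<in> S \<Longrightarrow> i \<ge> 1 \<Longrightarrow> b \<in> carrier (lev M 0) \<Longrightarrow> x \<in> carrier (lev M i) \<Longrightarrow>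
       act N i (if 0 \<in> S then b else \<one>\<^bsub>lev N 0\<^esub>) x = act M i b x"
  shows "isomorphic Crs M N"
proof -
  let ?f = "\<lambda>M N :: 'a crs. \<lambda>i. \<lambda>x\<in>carrier (lev M i). if i \<in> S then x else \<one>\<^bsub>lev N i\<^esub>"
  have f: "?f M N \<in> crs_hom M N"
    using crs_iso_trivial[OF M N 1 2 3 4] by simp
  have a4: "act M i (if 0 \<in> S then b else \<one>\<^bsub>lev M 0\<^esub>) x = act N i b x"
    if "i \<in> S" "i \<ge> 1" "b \<in> carrier (lev N 0)" "x \<in> carrier (lev N i)" for i b x
  proof (cases "0 \<in> S")
    case True then show ?thesis using 4[of i b x] that 1 by simp
  next
    case False
    then have "b = \<one>\<^bsub>lev N 0\<^esub>" using 2 that trivial_groupD by metis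
    moreover have "\<one>\<^bsub>lev M 0\<^esub> \<in> carrier (lev M 0)" using 2[OF False] by (auto simp: trivial_group_def)
    ultimately show ?thesis using 4[of i "\<one>\<^bsub>lev M 0\<^esub>" x] that 1 False by simp
  qed
  have g: "?f N M \<in> crs_hom N M"
    by (rule crs_iso_trivial[OF N M]) (use 1 2 3 a4 in auto)
  have inv: "(\<lambda>i. compose (carrier (lev A i)) (?f B A i) (?f A B i)) = (\<lambda>i. \<lambda>x\<in>carrier (lev A i). x)"
    if "\<And>i. i \<in> S \<Longrightarrow> lev B i = lev A i" "\<And>i. i \<notin> S \<Longrightarrow> trivial_group (lev A i) \<and> trivial_group (lev B i)"
    for A B :: "'a crs"
  proof (intro ext)
    fix i x
    show "compose (carrier (lev A i)) (?f B A i) (?f A B i) x = (\<lambda>x\<in>carrier (lev A i). x) x"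
    proof (cases "i \<in> S")
      case True then show ?thesis using that(1)[OF True] by (simp add: compose_def)
    next
      case False then show ?thesis using that(2)[OF False] by (auto simp: compose_def trivial_group_def)
    qed
  qed
  show ?thesis
    unfolding isomorphic_def
  proof (intro bexI conjI)
    show "?f M N \<in> Hom Crs M N" "?f N M \<in> Hom Crs N M" using f g by (simp_all add: Crs_def)
    show "Comp Crs M N M (?f N M) (?f M N) = Id Crs M" "Comp Crs N M N (?f M N) (?f N M) = Id Crs N"
      using inv[of N M] inv[of M N] 1 2 by (simp_all add: Crs_def)
  qed
qed

lemma isomorphic_trivial:
  assumes M: "M \<in> Ob Crs" and N: "N \<in> Ob Crs" and i: "isomorphic Crs M N" and t: "trivial_group (lev N i)"
  shows "trivial_group (lev M i)"
proof -
  interpret M: cc M using M by (simp add: Crs_def cc_def)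
  interpret N: cc N using N by (simp add: Crs_def cc_def)
  obtain f g where f: "f \<in> crs_hom M N" and g: "g \<in> crs_hom N M"
    and gf: "\<And>i. compose (carrier (lev M i)) (g i) (f i) = (\<lambda>x\<in>carrier (lev M i). x)"
    using i by (auto simp: isomorphic_def Crs_def fun_eq_iff)
  have "x = \<one>\<^bsub>lev M i\<^esub>" if x: "x \<in> carrier (lev M i)" for x
  proof -
    have "compose (carrier (lev M i)) (g i) (f i) x = x" using gf x by simp
    then have "x = g i (f i x)" using x by (simp add: compose_def)
    also have "f i x = \<one>\<^bsub>lev N i\<^esub>" by (rule trivial_groupD[OF t crs_homD(3)[OF f x]])
    also have "g i \<dots> = \<one>\<^bsub>lev M i\<^esub>" by (rule hom_one[OF crs_homD(1)[OF g] N.grp M.grp])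
    finally show ?thesis .
  qed
  then show ?thesis using M.grp[of i] group.is_monoid[OF M.grp[of i]] monoid.one_closed
    by (fastforce simp: trivial_group_def)
qed

lemma essential_image_sk1: "essential_image XMod Crs sk1 = Crs_le 1"
proof (intro equalityI subsetI)
  fix M :: "'a crs" assume M: "M \<in> essential_image XMod Crs sk1"
  then obtain X where X: "X \<in> Ob XMod" "isomorphic Crs M (FOb sk1 X)" "M \<in> Ob Crs"
    by (auto simp: essential_image_def)
  then show "M \<in> Crs_le 1"
    using isomorphic_trivial[OF X(3) _ X(2)] sk1_Crs_le[OF X(1)] by (auto simp: Crs_le_def)
next
  fix M :: "'a crs" assume M: "M \<in> Crs_le 1"
  then have cM: "crossed_complex M" by (simp add: Crs_le_def Crs_def)
  let ?X = "\<lparr>src = lev M 1, tgt = lev M 0, xbd = bd M 1, xact = act M 1\<rparr>"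
  have X: "?X \<in> Ob XMod" using cM by (simp add: XMod_def crossed_complex_def)
  then have cX: "crossed_complex (FOb sk1 ?X)" using sk1_Crs_le by (auto simp: Crs_le_def Crs_def)
  have "isomorphic Crs M (FOb sk1 ?X)"
  proof (rule crs_isomorphicI[where S = "{0, 1}", OF cM cX])
    fix i :: nat assume "i \<notin> {0, 1}"
    then show "trivial_group (lev M i) \<and> trivial_group (lev (FOb sk1 ?X) i)"
      using M trivial_singleton by (auto simp: Crs_le_def sk1_def sk1_lev_def)
  qed (auto simp: sk1_def sk1_lev_def)
  then show "M \<in> essential_image XMod Crs sk1"
    using X cM by (auto simp: essential_image_def Crs_def)
qed

lemma chn_to_crs_Crs_ge:
  assumes k: "1 \<le> k" and A: "A \<in> Ob (ChnAb_ge k)"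
  shows "FOb chn_to_crs A \<in> Crs_ge k"
proof -
  have c: "comm_group (clev A n)" for n using A by (simp add: ChnAb_ge_def chain_complex_def)
  have D: "1 \<le> n \<Longrightarrow> cbd A n \<in> hom (clev A n) (clev A (n - 1))" for n
    using A by (simp add: ChnAb_ge_def chain_complex_def)
  have Dc: "1 \<le> n \<Longrightarrow> x \<in> carrier (clev A n) \<Longrightarrow> cbd A n x \<in> carrier (clev A (n - 1))" for n x
    using D hom_in_carrier by metis
  have DD: "1 \<le> n \<Longrightarrow> x \<in> carrier (clev A (n + 1)) \<Longrightarrow> cbd A n (cbd A (n + 1) x) = \<one>\<^bsub>clev A (n - 1)\<^esub>" for n x
    using A by (simp add: ChnAb_ge_def chain_complex_def)
  have t: "trivial_group (clev A i)" if "i < k" for i using A that by (simp add: ChnAb_ge_def)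
  have g: "group (clev A n)" for n using c by (simp add: comm_group_def)
  have m: "monoid (clev A n)" for n using g group.is_monoid by blast
  have cm: "crossed_module (clev A 1) (clev A 0) (cbd A 1) (\<lambda>b. \<lambda>x\<in>carrier (clev A 1). x)"
    unfolding crossed_module_def
  proof (intro conjI ballI)
    fix b a assume b: "b \<in> carrier (clev A 0)" and a: "a \<in> carrier (clev A 1)"
    have z: "y = \<one>\<^bsub>clev A 0\<^esub>" if "y \<in> carrier (clev A 0)" for y
      using trivial_groupD[OF t that] k by simp
    have d: "cbd A 1 a \<in> carrier (clev A 0)" using Dc[of 1 a] a by simp
    have "b \<otimes>\<^bsub>clev A 0\<^esub> cbd A 1 a \<otimes>\<^bsub>clev A 0\<^esub> inv\<^bsub>clev A 0\<^esub> b \<in> carrier (clev A 0)"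
      using b d g m by (simp add: group.inv_closed monoid.m_closed)
    then have "b \<otimes>\<^bsub>clev A 0\<^esub> cbd A 1 a \<otimes>\<^bsub>clev A 0\<^esub> inv\<^bsub>clev A 0\<^esub> b = cbd A 1 a"
      using z d by metis
    then show "cbd A 1 ((\<lambda>x\<in>carrier (clev A 1). x) a) =
        b \<otimes>\<^bsub>clev A 0\<^esub> cbd A 1 a \<otimes>\<^bsub>clev A 0\<^esub> inv\<^bsub>clev A 0\<^esub> b" using a by simp
  next
    fix a a' assume a: "a \<in> carrier (clev A 1)" "a' \<in> carrier (clev A 1)"
    interpret comm_group "clev A 1" by (rule c)
    have "a \<otimes>\<^bsub>clev A 1\<^esub> a' \<otimes>\<^bsub>clev A 1\<^esub> inv\<^bsub>clev A 1\<^esub> a = a'"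
      using a by (metis inv_closed m_comm m_assoc r_inv r_one)
    then show "(\<lambda>x\<in>carrier (clev A 1). x) a' = a \<otimes>\<^bsub>clev A 1\<^esub> a' \<otimes>\<^bsub>clev A 1\<^esub> inv\<^bsub>clev A 1\<^esub> a"
      using a by simp
  qed (use g D[of 1] trivial_action_hom in auto)
  have ah: "(\<lambda>b. \<lambda>x\<in>carrier (clev A n). x) \<in> hom (clev A 0) (AutoGroup (clev A n))" for n
    by (rule trivial_action_hom[OF g])
  have "crossed_complex (FOb chn_to_crs A)"
    unfolding crossed_complex_def chn_to_crs_def
    using g c D DD cm comm_group_normal[OF c g D] ah Dc
    by (simp add: one_AutoGroup del: One_nat_def)
  then show ?thesis using t by (simp add: Crs_ge_def Crs_def) (simp add: chn_to_crs_def)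
qed

lemma chn_to_crs_fully_faithful:
  assumes k: "1 \<le> k"
  shows "fully_faithful (ChnAb_ge k) Crs chn_to_crs"
proof -
  have Ob: "FOb chn_to_crs A \<in> Ob Crs" if "A \<in> Ob (ChnAb_ge k)" for A :: "'a chn"
    using chn_to_crs_Crs_ge[OF k that] by (simp add: Crs_ge_def)
  have hom: "crs_hom (FOb chn_to_crs A) (FOb chn_to_crs B) = chn_hom A B" for A B :: "'a chn"
    by (auto simp: crs_hom_def chn_hom_def chn_to_crs_def dest: hom_in_carrier)
  show ?thesis
    unfolding fully_faithful_def is_functor_def
    using Ob hom by (auto simp: ChnAb_ge_def Crs_def chn_to_crs_def bij_betw_def)
qed

lemma essential_image_chn_to_crs:
  assumes k: "1 \<le> k"
  shows "essential_image (ChnAb_ge k) Crs chn_to_crs = Crs_ge k"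
proof (intro equalityI subsetI)
  fix M :: "'a crs" assume M: "M \<in> essential_image (ChnAb_ge k) Crs chn_to_crs"
  then obtain X where X: "X \<in> Ob (ChnAb_ge k)" "isomorphic Crs M (FOb chn_to_crs X)" "M \<in> Ob Crs"
    by (auto simp: essential_image_def)
  then show "M \<in> Crs_ge k"
    using isomorphic_trivial[OF X(3) _ X(2)] chn_to_crs_Crs_ge[OF k X(1)] by (auto simp: Crs_ge_def)
next
  fix M :: "'a crs" assume M: "M \<in> Crs_ge k"
  then have cM: "crossed_complex M" and t: "\<And>i. i < k \<Longrightarrow> trivial_group (lev M i)"
    by (simp_all add: Crs_ge_def Crs_def)
  interpret cc M by (rule cc.intro) fact
  let ?A = "\<lparr>clev = lev M, cbd = bd M\<rparr>"
  have id: "act M n b x = x" if n: "1 \<le> n" and b: "b \<in> carrier (lev M 0)" and x: "x \<in> carrier (lev M n)" for n b x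
    using trivial_groupD[OF t b] act_one[OF n x] k by simp
  have "comm_group (lev M n)" for n
  proof (cases "2 \<le> n")
    case True then show ?thesis by (rule comm)
  next
    case False
    show ?thesis
    proof (rule group.group_comm_groupI[OF grp])
      fix x y assume xy: "x \<in> carrier (lev M n)" "y \<in> carrier (lev M n)"
      show "x \<otimes>\<^bsub>lev M n\<^esub> y = y \<otimes>\<^bsub>lev M n\<^esub> x"
      proof (cases "n = 0")
        case True
        then show ?thesis using xy trivial_groupD[OF t] k by (metis less_le_trans less_numeral_extra(1))
      next
        case False
        then have n: "n = 1" using \<open>\<not> 2 \<le> n\<close> by simp
        have "y = act M 1 (bd M 1 x) y" using id[of 1 "bd M 1 x" y] xy bdc[of 1 x] n by simp
        also have "\<dots> = x \<otimes>\<^bsub>lev M n\<^esub> y \<otimes>\<^bsub>lev M n\<^esub> inv\<^bsub>lev M n\<^esub> x"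
          using cm xy n by (simp add: crossed_module_def)
        finally show ?thesis
          using group.inv_solve_right[OF grp[of n], of y "x \<otimes>\<^bsub>lev M n\<^esub> y" x] xy
            monoid.m_closed[OF group.is_monoid[OF grp[of n]]] by metis
      qed
    qed
  qed
  then have A: "?A \<in> Ob (ChnAb_ge k)"
    using t bdh bdbd by (simp add: ChnAb_ge_def chain_complex_def)
  then have cA: "crossed_complex (FOb chn_to_crs ?A)"
    using chn_to_crs_Crs_ge[OF k A] by (simp add: Crs_ge_def Crs_def)
  have "isomorphic Crs M (FOb chn_to_crs ?A)"
    by (rule crs_isomorphicI[where S = UNIV, OF cM cA]) (auto simp: chn_to_crs_def id)
  then show "M \<in> essential_image (ChnAb_ge k) Crs chn_to_crs"
    using A cM by (auto simp: essential_image_def Crs_def)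
qed

end

theory Submission
  imports Defs
begin

text \<open>
  The whole theorem rests on one fact, \<open>short_exact_kernel\<close>: if every component of a morphism
  \<open>f : M \<rightarrow> N\<close> of crossed complexes is surjective, then \<open>f\<close> and its kernel form a short exact
  sequence. Here the kernel is computed level by level. This works because a family of subgroups
  of \<open>M\<close> that is closed under the differentials and the actions is always a crossed complex again
  (\<open>sub_cc\<close>): properness, the only doubtful axiom, follows from the other ones.

  For the first pair, \<open>f\<close> is the unit \<open>M \<rightarrow> cot\<^sub>k M\<close> with \<open>k = n - 1\<close>. Its kernel is trivial below
  degree \<open>k\<close>, equals \<open>\<delta>(M\<^sub>k\<^sub>+\<^sub>1)\<close> in degree \<open>k\<close> and equals \<open>M\<close> above, so it lies in \<open>Ker(cot\<^sub>k)\<close>: by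
  \<open>Ker_cot_iff\<close>, that class consists of the complexes which vanish below degree \<open>k\<close> and whose
  differential is onto \<open>M\<^sub>k\<close>. A morphism from such a complex to a \<open>k\<close>-truncated one is zero in degree
  \<open>k\<close> because it commutes with the differential and degree \<open>k + 1\<close> of the target is trivial; in the
  other degrees, source or target is trivial. The coreflection onto the \<open>k\<close>-truncated complexes
  discards everything above degree \<open>k\<close>. That leaves a subcomplex, hence the counit is a
  monomorphism, and every morphism out of a \<open>k\<close>-truncated complex lands in it.

  For the second pair, \<open>f\<close> is the projection of \<open>M\<close> onto its part in degrees \<open>\<ge> n\<close>, whose kernel is
  the part below. In the target the group in degree \<open>0\<close> is trivial and so acts trivially; hence the
  projection preserves the actions exactly when those of \<open>M\<close> are trivial in degrees \<open>\<ge> n\<close>. This is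
  where the class \<open>\<E>\<close> comes from. Finally, the image of \<open>\<delta>\<^sub>1\<close> always acts trivially in degrees
  \<open>\<ge> 2\<close>, so surjectivity of \<open>\<delta>\<^sub>1\<close> puts \<open>M\<close> in \<open>\<E>\<close>.
\<close>

section \<open>Morphisms and zero objects of crossed complexes\<close>

lemma Crs_simps:
  "M \<in> Ob Crs \<longleftrightarrow> crossed_complex M"
  "Hom Crs M N = crs_hom M N"
  "Id Crs M = (\<lambda>n. \<lambda>x\<in>carrier (lev M n). x)"
  "Comp Crs M N P g f = (\<lambda>n. compose (carrier (lev M n)) (g n) (f n))"
  by (simp_all add: Crs_def)

lemma crs_homI:
  assumes "\<And>n. f n \<in> hom (lev M n) (lev N n)" "\<And>n. f n \<in> extensional (carrier (lev M n))"
    and "\<And>n x. 1 \<le> n \<Longrightarrow> x \<in> carrier (lev M n) \<Longrightarrow> f (n - 1) (bd M n x) = bd N n (f n x)"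
    and "\<And>n b x. 1 \<le> n \<Longrightarrow> b \<in> carrier (lev M 0) \<Longrightarrow> x \<in> carrier (lev M n) \<Longrightarrow>
       f n (act M n b x) = act N n (f 0 b) (f n x)"
  shows "f \<in> crs_hom M N"
  using assms by (simp add: crs_hom_def)

lemma crs_hom_eqI:
  assumes "f \<in> crs_hom M N" "g \<in> crs_hom M P"
    and "\<And>n x. x \<in> carrier (lev M n) \<Longrightarrow> f n x = g n x"
  shows "f = g"
  using assms crs_homD(2) by (metis (no_types, lifting) ext extensionalityI)

lemma crs_hom_compose:
  assumes "crossed_complex M" "crossed_complex N" "crossed_complex P"
    and "f \<in> crs_hom M N" "g \<in> crs_hom N P"
  shows "(\<lambda>n. compose (carrier (lev M n)) (g n) (f n)) \<in> crs_hom M P"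
proof -
  have "M \<in> Ob Crs" "N \<in> Ob Crs" "P \<in> Ob Crs" using assms by (simp_all add: Crs_simps)
  from category_Crs[unfolded category_def Crs_simps, THEN conjunct2, THEN conjunct1, rule_format,
      OF this assms(4,5)]
  show ?thesis .
qed

lemma crs_hom_id: "crossed_complex M \<Longrightarrow> (\<lambda>n. \<lambda>x\<in>carrier (lev M n). x) \<in> crs_hom M M"
  using category_Crs unfolding category_def by (auto simp: Crs_simps)

definition crs_one :: "'a crs \<Rightarrow> 'a crs \<Rightarrow> nat \<Rightarrow> 'a \<Rightarrow> 'a" where
  "crs_one M N n = (\<lambda>x\<in>carrier (lev M n). \<one>\<^bsub>lev N n\<^esub>)"

lemma crs_one_hom:
  assumes M: "crossed_complex M" and N: "crossed_complex N"
  shows "crs_one M N \<in> crs_hom M N"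
proof -
  interpret M: cc M by (rule cc.intro) fact
  interpret N: cc N by (rule cc.intro) fact
  show ?thesis
  proof (rule crs_homI)
    fix n
    show "crs_one M N n \<in> hom (lev M n) (lev N n)"
      unfolding crs_one_def by (rule one_hom(2)[OF M.grp N.grp])
    show "crs_one M N n \<in> extensional (carrier (lev M n))"
      by (simp add: crs_one_def)
  next
    fix n x assume n: "1 \<le> (n::nat)" and x: "x \<in> carrier (lev M n)"
    then show "crs_one M N (n - 1) (bd M n x) = bd N n (crs_one M N n x)"
      using M.bdc[OF n x] hom_one[OF N.bdh[OF n] N.grp N.grp] by (simp add: crs_one_def)
  next
    fix n b x
    assume n: "1 \<le> (n::nat)" and b: "b \<in> carrier (lev M 0)" and x: "x \<in> carrier (lev M n)"
    have "\<one>\<^bsub>lev N 0\<^esub> \<in> carrier (lev N 0)" by (rule monoid.one_closed[OF group.is_monoid[OF N.grp]])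
    from hom_one[OF N.act_hom[OF n this] N.grp N.grp]
    show "crs_one M N n (act M n b x) = act N n (crs_one M N 0 b) (crs_one M N n x)"
      using M.actc[OF n b x] b x by (simp add: crs_one_def)
  qed
qed

text \<open>
  For a zero object the identity and the constant morphism agree, by uniqueness, so that every
  element is the unit.
\<close>

lemma zero_object_Crs_iff:
  "zero_object Crs Z \<longleftrightarrow> crossed_complex Z \<and> (\<forall>n. trivial_group (lev Z n))"
proof (intro iffI conjI allI)
  assume Z: "zero_object Crs Z"
  then show cZ: "crossed_complex Z" by (simp add: zero_object_def Crs_simps)
  interpret cc Z by (rule cc.intro) fact
  have "\<forall>X\<in>Ob Crs. \<exists>!f. f \<in> crs_hom Z X"
    using Z by (simp add: zero_object_def Crs_simps(2))
  moreover have "Z \<in> Ob Crs" using cZ by (simp add: Crs_simps)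
  ultimately have "\<exists>!f. f \<in> crs_hom Z Z" by (rule bspec)
  then have "crs_one Z Z = (\<lambda>n. \<lambda>x\<in>carrier (lev Z n). x)"
    using crs_one_hom[OF cZ cZ] crs_hom_id[OF cZ] by (elim ex1E) metis
  then have "crs_one Z Z n x = (\<lambda>x\<in>carrier (lev Z n). x) x" for n x by metis
  then have "x = \<one>\<^bsub>lev Z n\<^esub>" if "x \<in> carrier (lev Z n)" for n x
    using that by (metis crs_one_def restrict_apply')
  then show "trivial_group (lev Z n)" for n
    using grp[of n] monoid.one_closed[OF group.is_monoid[OF grp[of n]]]
    by (auto simp: trivial_group_def)
next
  assume a: "crossed_complex Z \<and> (\<forall>n. trivial_group (lev Z n))"
  then have cZ: "crossed_complex Z" and t: "\<And>n. trivial_group (lev Z n)" by auto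
  interpret cc Z by (rule cc.intro) fact
  have "\<exists>!f. f \<in> crs_hom Z X" "\<exists>!f. f \<in> crs_hom X Z" if X: "crossed_complex X" for X
  proof -
    interpret X: cc X by (rule cc.intro) fact
    have 1: "f n x = \<one>\<^bsub>lev X n\<^esub>" if "f \<in> crs_hom Z X" "x \<in> carrier (lev Z n)" for f n x
      using trivial_groupD[OF t that(2)] hom_one[OF crs_homD(1)[OF that(1)] grp X.grp] by metis
    show "\<exists>!f. f \<in> crs_hom Z X"
      by (rule ex1I, rule crs_one_hom[OF cZ X], rule crs_hom_eqI[OF _ crs_one_hom[OF cZ X]], assumption)
        (simp add: 1 crs_one_def)
    have 2: "f n x = \<one>\<^bsub>lev Z n\<^esub>" if "f \<in> crs_hom X Z" "x \<in> carrier (lev X n)" for f n x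
      using trivial_groupD[OF t crs_homD(3)[OF that]] .
    show "\<exists>!f. f \<in> crs_hom X Z"
      by (rule ex1I, rule crs_one_hom[OF X cZ], rule crs_hom_eqI[OF _ crs_one_hom[OF X cZ]], assumption)
        (simp add: 2 crs_one_def)
  qed
  then show "zero_object Crs Z" using cZ by (simp add: zero_object_def Crs_simps)
qed


section \<open>Subcomplexes and zero morphisms\<close>

definition sub_crs :: "'a crs \<Rightarrow> (nat \<Rightarrow> 'a set) \<Rightarrow> 'a crs" where
  "sub_crs M S = \<lparr>lev = (\<lambda>n. (lev M n)\<lparr>carrier := S n\<rparr>), bd = bd M,
     act = (\<lambda>n b. restrict (act M n b) (S n))\<rparr>"

definition sub_incl :: "(nat \<Rightarrow> 'a set) \<Rightarrow> nat \<Rightarrow> 'a \<Rightarrow> 'a" where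
  "sub_incl S n = (\<lambda>x\<in>S n. x)"

lemma sub_crs_simps [simp]:
  "carrier (lev (sub_crs M S) n) = S n"
  "one (lev (sub_crs M S) n) = one (lev M n)"
  "mult (lev (sub_crs M S) n) = mult (lev M n)"
  "bd (sub_crs M S) = bd M"
  "x \<in> S n \<Longrightarrow> act (sub_crs M S) n b x = act M n b x"
  by (simp_all add: sub_crs_def)

text \<open>
  The group acting on the subcomplex is \<open>S 0\<close>, so stability is understood with respect to \<open>S 0\<close>
  rather than \<open>M\<^sub>0\<close>.
\<close>

locale subcomplex = cc M for M :: "'a crs" +
  fixes S :: "nat \<Rightarrow> 'a set"
  assumes sub: "subgroup (S n) (lev M n)"
    and sub_bd: "1 \<le> n \<Longrightarrow> x \<in> S n \<Longrightarrow> bd M n x \<in> S (n - 1)"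
    and sub_act: "1 \<le> n \<Longrightarrow> b \<in> S 0 \<Longrightarrow> x \<in> S n \<Longrightarrow> act M n b x \<in> S n"
begin

lemma subc: "x \<in> S n \<Longrightarrow> x \<in> carrier (lev M n)"
  using sub subgroup.subset by blast

lemma lev_eq: "lev (sub_crs M S) n = (lev M n)\<lparr>carrier := S n\<rparr>"
  by (simp add: sub_crs_def)

lemma sub_grp: "group (lev (sub_crs M S) n)"
  unfolding lev_eq by (rule subgroup.subgroup_is_group[OF sub grp])

lemma sub_inv: "x \<in> S n \<Longrightarrow> inv\<^bsub>lev (sub_crs M S) n\<^esub> x = inv\<^bsub>lev M n\<^esub> x"
  unfolding lev_eq by (rule group.m_inv_consistent[OF grp sub])

text \<open>
  Since \<open>\<delta>\<^sub>1 \<delta>\<^sub>2 = 1\<close>, the Peiffer identity turns conjugation by \<open>\<delta>\<^sub>2 x\<close> into the action of the unit.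
\<close>

lemma bd2_central:
  assumes x: "x \<in> carrier (lev M 2)" and a: "a \<in> carrier (lev M 1)"
  shows "bd M 2 x \<otimes>\<^bsub>lev M 1\<^esub> a \<otimes>\<^bsub>lev M 1\<^esub> inv\<^bsub>lev M 1\<^esub> (bd M 2 x) = a"
proof -
  have d: "bd M 2 x \<in> carrier (lev M 1)" using bdc[of 2 x] x by simp
  have "bd M 1 (bd M 2 x) = \<one>\<^bsub>lev M 0\<^esub>" using bdbd[of 1 x] x by (simp add: numeral_2_eq_2)
  then have "act M 1 (bd M 1 (bd M 2 x)) a = a" using act_one[of 1 a] a by simp
  then show ?thesis using cm d a by (simp add: crossed_module_def)
qed

text \<open>
  Subgroups need not inherit normality of images, yet properness survives: in degree \<open>0\<close> the image
  of the differential of a crossed module is always normal, in degree \<open>1\<close> the image of \<open>\<delta>\<^sub>2\<close> is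
  central, and from degree \<open>2\<close> on the groups are abelian.
\<close>

lemma sub_cc: "crossed_complex (sub_crs M S)"
proof -
  let ?N = "sub_crs M S"
  have bdh': "bd ?N n \<in> hom (lev ?N n) (lev ?N (n - 1))" if n: "1 \<le> n" for n
    using sub_bd[OF n] by (auto intro!: homI simp: subc hom_mult[OF bdh[OF n]])
  have comm': "comm_group (lev ?N n)" if "2 \<le> n" for n
    by (rule group.group_comm_groupI[OF sub_grp])
      (simp add: subc comm_groupE(4)[OF comm[OF that]])
  have acth': "act ?N n \<in> hom (lev ?N 0) (AutoGroup (lev ?N n))" if n: "1 \<le> n" for n
  proof (rule hom_AutoGroupI[OF sub_grp sub_grp])
    fix b assume b: "b \<in> carrier (lev ?N 0)"
    have "act ?N n b \<in> hom (lev ?N n) (lev ?N n)"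
    proof (rule homI)
      fix x y assume xy: "x \<in> carrier (lev ?N n)" "y \<in> carrier (lev ?N n)"
      then have "x \<otimes>\<^bsub>lev M n\<^esub> y \<in> S n" using subgroup.m_closed[OF sub] by simp
      then show "act ?N n b (x \<otimes>\<^bsub>lev ?N n\<^esub> y) = act ?N n b x \<otimes>\<^bsub>lev ?N n\<^esub> act ?N n b y"
        using xy b n by (simp add: hom_mult[OF act_hom] subc)
    qed (use b n sub_act in simp)
    then show "act ?N n b \<in> hom (lev ?N n) (lev ?N n) \<inter> extensional (carrier (lev ?N n))"
      by (simp add: sub_crs_def)
  qed (use n in \<open>simp_all add: sub_act act_mult act_one subc\<close>)
  have cm': "crossed_module (lev ?N 1) (lev ?N 0) (bd ?N 1) (act ?N 1)"
    unfolding crossed_module_def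
  proof (intro conjI ballI)
    fix b a assume "b \<in> carrier (lev ?N 0)" "a \<in> carrier (lev ?N 1)"
    then show "bd ?N 1 (act ?N 1 b a) = b \<otimes>\<^bsub>lev ?N 0\<^esub> bd ?N 1 a \<otimes>\<^bsub>lev ?N 0\<^esub> inv\<^bsub>lev ?N 0\<^esub> b"
      using cm by (simp add: sub_inv subc crossed_module_def del: One_nat_def)
  next
    fix a c assume "a \<in> carrier (lev ?N 1)" "c \<in> carrier (lev ?N 1)"
    then show "act ?N 1 (bd ?N 1 a) c = a \<otimes>\<^bsub>lev ?N 1\<^esub> c \<otimes>\<^bsub>lev ?N 1\<^esub> inv\<^bsub>lev ?N 1\<^esub> a"
      using cm by (simp add: sub_inv subc crossed_module_def del: One_nat_def)
  qed (use sub_grp bdh'[of 1] acth'[of 1] in auto)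
  have normal': "bd ?N n ` carrier (lev ?N n) \<lhd> lev ?N (n - 1)" if n: "1 \<le> n" for n
  proof -
    consider "n = 1" | "n = 2" | "3 \<le> n" using n by linarith
    then show ?thesis
    proof cases
      case 1 then show ?thesis using crossed_module_normal[OF cm'] by simp
    next
      case 3
      then have "2 \<le> n - 1" by simp
      then show ?thesis using comm_group_normal[OF comm' sub_grp bdh'[OF n]] by blast
    next
      case 2
      interpret N: group "lev ?N 1" by (rule sub_grp)
      interpret M1: group "lev M 1" by (rule grp)
      interpret h: group_hom "lev ?N 2" "lev ?N 1" "bd ?N 2"
        using bdh'[of 2] sub_grp by (simp add: group_hom_def group_hom_axioms_def)
      have "bd ?N 2 ` carrier (lev ?N 2) \<lhd> lev ?N 1"
      proof (rule N.normal_invI[OF h.img_is_subgroup])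
        fix a h assume a: "a \<in> carrier (lev ?N 1)" and "h \<in> bd ?N 2 ` carrier (lev ?N 2)"
        then obtain x where x: "x \<in> S 2" "h = bd M 2 x" by auto
        have h: "h \<in> carrier (lev M 1)" using bdc[of 2 x] x subc by simp
        have a1: "a \<in> carrier (lev M 1)" using a subc by simp
        have "h \<otimes>\<^bsub>lev M 1\<^esub> a = a \<otimes>\<^bsub>lev M 1\<^esub> h"
          using bd2_central[of x a] x subc a1 h by (metis group.inv_solve_right'[OF grp] monoid.m_closed[OF group.is_monoid[OF grp]])
        then have "a \<otimes>\<^bsub>lev M 1\<^esub> h \<otimes>\<^bsub>lev M 1\<^esub> inv\<^bsub>lev M 1\<^esub> a = h"
          using a1 h by (metis group.inv_solve_right'[OF grp] monoid.m_closed[OF group.is_monoid[OF grp]])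
        then show "a \<otimes>\<^bsub>lev ?N 1\<^esub> h \<otimes>\<^bsub>lev ?N 1\<^esub> inv\<^bsub>lev ?N 1\<^esub> a \<in> bd ?N 2 ` carrier (lev ?N 2)"
          using a x sub_inv[of a 1] by (simp del: One_nat_def)
      qed
      then show ?thesis using 2 by simp
    qed
  qed
  have "act ?N n (bd ?N 1 x) = \<one>\<^bsub>AutoGroup (lev ?N n)\<^esub>" if "2 \<le> n" "x \<in> S 1" for n x
    using act_bd1[OF that(1) subc[OF that(2)]]
    by (auto simp: one_AutoGroup sub_crs_def subc fun_eq_iff restrict_def)
  then show ?thesis
    unfolding crossed_complex_def
    using sub_grp comm' bdh' normal' acth' cm'
    by (simp add: bdbd equiv subc sub_act sub_bd del: One_nat_def)
qed

lemma sub_incl_hom: "sub_incl S \<in> crs_hom (sub_crs M S) M"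
proof (rule crs_homI)
  fix n show "sub_incl S n \<in> hom (lev (sub_crs M S) n) (lev M n)"
    by (rule homI) (simp_all add: sub_incl_def subc subgroup.m_closed[OF sub])
qed (simp_all add: sub_incl_def sub_bd sub_act del: One_nat_def)

text \<open>
  Operations and differentials of the subcomplex are those of \<open>M\<close>, so the very same family of maps
  serves as its own factorisation through the inclusion.
\<close>

lemma sub_lift:
  assumes "f \<in> crs_hom W M" "\<And>n x. x \<in> carrier (lev W n) \<Longrightarrow> f n x \<in> S n"
  shows "f \<in> crs_hom W (sub_crs M S)"
proof (rule crs_homI)
  fix n
  show "f n \<in> hom (lev W n) (lev (sub_crs M S) n)"
    using assms(2) by (auto intro!: homI simp: hom_mult[OF crs_homD(1)[OF assms(1)]])
  show "f n \<in> extensional (carrier (lev W n))" by (rule crs_homD(2)[OF assms(1)])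
qed (simp_all add: assms crs_homD(4,5)[OF assms(1)] del: One_nat_def)

lemma sub_incl_monomorphism: "monomorphism Crs (sub_crs M S) M (sub_incl S)"
  unfolding monomorphism_def Crs_simps
proof (intro conjI ballI impI sub_incl_hom)
  fix W g h
  assume gh: "g \<in> crs_hom W (sub_crs M S)" "h \<in> crs_hom W (sub_crs M S)"
    and e: "(\<lambda>n. compose (carrier (lev W n)) (sub_incl S n) (g n)) =
       (\<lambda>n. compose (carrier (lev W n)) (sub_incl S n) (h n))"
  show "g = h"
  proof (rule crs_hom_eqI[OF gh])
    fix n x assume x: "x \<in> carrier (lev W n)"
    have "compose (carrier (lev W n)) (sub_incl S n) (g n) x =
       compose (carrier (lev W n)) (sub_incl S n) (h n) x" using e by metis
    then show "g n x = h n x"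
      using x crs_homD(3)[OF gh(1) x] crs_homD(3)[OF gh(2) x] by (simp add: compose_def sub_incl_def)
  qed
qed

lemma sub_incl_lift:
  assumes "f \<in> crs_hom W M" "\<And>n x. x \<in> carrier (lev W n) \<Longrightarrow> f n x \<in> S n"
  shows "\<exists>!u. u \<in> crs_hom W (sub_crs M S) \<and> Comp Crs W (sub_crs M S) M (sub_incl S) u = f"
proof (rule ex1I)
  have e: "compose (carrier (lev W n)) (sub_incl S n) (f n) = f n" for n
    by (rule extensionalityI[OF compose_extensional crs_homD(2)[OF assms(1)]])
      (simp add: compose_def sub_incl_def assms(2))
  then show "f \<in> crs_hom W (sub_crs M S) \<and> Comp Crs W (sub_crs M S) M (sub_incl S) f = f"
    using sub_lift[OF assms] by (simp add: Crs_simps)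
  fix u assume u: "u \<in> crs_hom W (sub_crs M S) \<and> Comp Crs W (sub_crs M S) M (sub_incl S) u = f"
  show "u = f"
  proof (rule crs_hom_eqI)
    fix n x assume x: "x \<in> carrier (lev W n)"
    have "f n x = compose (carrier (lev W n)) (sub_incl S n) (u n) x" using u by (auto simp: Crs_simps)
    then show "u n x = f n x" using x crs_homD(3)[of u W "sub_crs M S" x n] u
      by (simp add: compose_def sub_incl_def)
  qed (use u assms in auto)
qed

end

text \<open>
  A factorisation of a constant morphism needs some zero object over the type \<open>'a\<close>; the subcomplex
  of units of \<open>M\<close> is one.
\<close>

lemma zero_morphism_Crs_iff:
  assumes M: "crossed_complex M" and N: "crossed_complex N" and f: "f \<in> crs_hom M N"
  shows "zero_morphism Crs M N f \<longleftrightarrow> (\<forall>n. \<forall>x\<in>carrier (lev M n). f n x = \<one>\<^bsub>lev N n\<^esub>)"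
proof
  assume "zero_morphism Crs M N f"
  then obtain Z g h where Z: "zero_object Crs Z" and g: "g \<in> crs_hom M Z" and h: "h \<in> crs_hom Z N"
    and fe: "f = (\<lambda>n. compose (carrier (lev M n)) (h n) (g n))"
    by (auto simp: zero_morphism_def Crs_simps)
  interpret Z: cc Z using Z by (simp add: zero_object_Crs_iff cc_def)
  interpret N: cc N by (rule cc.intro) fact
  have "g n x = \<one>\<^bsub>lev Z n\<^esub>" if "x \<in> carrier (lev M n)" for n x
    using trivial_groupD[OF _ crs_homD(3)[OF g that]] Z by (simp add: zero_object_Crs_iff)
  then show "\<forall>n. \<forall>x\<in>carrier (lev M n). f n x = \<one>\<^bsub>lev N n\<^esub>"
    using hom_one[OF crs_homD(1)[OF h] Z.grp N.grp] by (simp add: fe compose_def)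
next
  assume f1: "\<forall>n. \<forall>x\<in>carrier (lev M n). f n x = \<one>\<^bsub>lev N n\<^esub>"
  interpret M: cc M by (rule cc.intro) fact
  let ?S = "\<lambda>n. {\<one>\<^bsub>lev M n\<^esub>}"
  interpret Z: subcomplex M ?S
  proof (intro subcomplex.intro subcomplex_axioms.intro M.cc_axioms)
    fix n
    show "subgroup {\<one>\<^bsub>lev M n\<^esub>} (lev M n)" by (rule group.triv_subgroup[OF M.grp])
  next
    fix n x assume "1 \<le> (n::nat)" "x \<in> {\<one>\<^bsub>lev M n\<^esub>}"
    then show "bd M n x \<in> {\<one>\<^bsub>lev M (n - 1)\<^esub>}" using hom_one[OF M.bdh M.grp M.grp] by simp
  next
    fix n b x assume "1 \<le> (n::nat)" "b \<in> {\<one>\<^bsub>lev M 0\<^esub>}" "x \<in> {\<one>\<^bsub>lev M n\<^esub>}"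
    then show "act M n b x \<in> {\<one>\<^bsub>lev M n\<^esub>}"
      using M.act_one monoid.one_closed[OF group.is_monoid[OF M.grp]] by simp
  qed
  let ?Z = "sub_crs M ?S"
  have "zero_object Crs ?Z"
    using Z.sub_cc Z.sub_grp by (simp add: zero_object_Crs_iff trivial_group_def)
  moreover have "f = Comp Crs M ?Z N (crs_one ?Z N) (crs_one M ?Z)"
    unfolding Crs_simps
    by (rule crs_hom_eqI[OF f crs_hom_compose[OF M Z.sub_cc N crs_one_hom[OF M Z.sub_cc] crs_one_hom[OF Z.sub_cc N]]])
      (simp add: f1 crs_one_def compose_def)
  ultimately show "zero_morphism Crs M N f"
    unfolding zero_morphism_def using crs_one_hom[OF M Z.sub_cc] crs_one_hom[OF Z.sub_cc N]
    by (auto simp: Crs_simps)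
qed


section \<open>Levelwise surjections are cokernels of their kernels\<close>

definition crs_ker :: "'a crs \<Rightarrow> 'a crs \<Rightarrow> (nat \<Rightarrow> 'a \<Rightarrow> 'a) \<Rightarrow> nat \<Rightarrow> 'a set" where
  "crs_ker M N f n = kernel (lev M n) (lev N n) (f n)"

lemma mem_crs_ker: "x \<in> crs_ker M N f n \<longleftrightarrow> x \<in> carrier (lev M n) \<and> f n x = \<one>\<^bsub>lev N n\<^esub>"
  by (simp add: crs_ker_def kernel_def)

locale crs_morphism = M: cc M + N: cc N for M N :: "'a crs" + 
  fixes f assumes f: "f \<in> crs_hom M N"
begin

lemma f_group_hom: "group_hom (lev M n) (lev N n) (f n)"
  using M.grp N.grp crs_homD(1)[OF f] by (simp add: group_hom_def group_hom_axioms_def)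

sublocale ker: subcomplex M "crs_ker M N f"
proof (intro subcomplex.intro subcomplex_axioms.intro M.cc_axioms)
  fix n
  show "subgroup (crs_ker M N f n) (lev M n)"
    unfolding crs_ker_def by (rule group_hom.subgroup_kernel[OF f_group_hom])
next
  fix n x assume n: "1 \<le> (n::nat)" and x: "x \<in> crs_ker M N f n"
  then have "f (n - 1) (bd M n x) = bd N n \<one>\<^bsub>lev N n\<^esub>"
    using crs_homD(4)[OF f n] by (simp add: mem_crs_ker)
  then show "bd M n x \<in> crs_ker M N f (n - 1)"
    using x M.bdc[OF n] hom_one[OF N.bdh[OF n] N.grp N.grp] by (simp add: mem_crs_ker)
next
  fix n b x assume n: "1 \<le> (n::nat)" and b: "b \<in> crs_ker M N f 0" and x: "x \<in> crs_ker M N f n"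
  then have "f n (act M n b x) = act N n \<one>\<^bsub>lev N 0\<^esub> \<one>\<^bsub>lev N n\<^esub>"
    using crs_homD(5)[OF f n] by (simp add: mem_crs_ker)
  then show "act M n b x \<in> crs_ker M N f n"
    using b x M.actc[OF n] N.act_one[OF n monoid.one_closed[OF group.is_monoid[OF N.grp]]]
    by (simp add: mem_crs_ker)
qed

lemma kernel_Crs: "is_kernel Crs (sub_crs M (crs_ker M N f)) M N (sub_incl (crs_ker M N f)) f"
proof -
  let ?S = "crs_ker M N f" let ?K = "sub_crs M ?S"
  have k: "(\<lambda>n. compose (carrier (lev ?K n)) (f n) (sub_incl ?S n)) \<in> crs_hom ?K N"
    by (rule crs_hom_compose[OF ker.sub_cc M.cc N.cc ker.sub_incl_hom f])
  have "zero_morphism Crs ?K N (Comp Crs ?K M N f (sub_incl ?S))"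
    unfolding Crs_simps zero_morphism_Crs_iff[OF ker.sub_cc N.cc k]
    by (simp add: compose_def sub_incl_def mem_crs_ker)
  moreover have "\<exists>!u. u \<in> crs_hom W ?K \<and> Comp Crs W ?K M (sub_incl ?S) u = h"
    if W: "crossed_complex W" and h: "h \<in> crs_hom W M"
      and z: "zero_morphism Crs W N (Comp Crs W M N f h)" for W h
  proof (rule ker.sub_incl_lift[OF h])
    fix n x assume x: "x \<in> carrier (lev W n)"
    have "compose (carrier (lev W n)) (f n) (h n) x = \<one>\<^bsub>lev N n\<^esub>"
      using z x zero_morphism_Crs_iff[OF W N.cc crs_hom_compose[OF W M.cc N.cc h f]]
      by (simp add: Crs_simps)
    then show "h n x \<in> ?S n" using x crs_homD(3)[OF h x] by (simp add: mem_crs_ker compose_def)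
  qed
  ultimately show ?thesis
    unfolding is_kernel_def using ker.sub_cc ker.sub_incl_hom f by (simp add: Crs_simps)
qed

text \<open>
  Each \<open>f n\<close> exhibits \<open>N\<^sub>n\<close> as a quotient of \<open>M\<^sub>n\<close>, and \<open>h n\<close> is constant on its fibres. The induced maps
  are compatible with differentials and actions because \<open>h\<close> is and every element of \<open>N\<close>, including
  the acting ones in \<open>N\<^sub>0\<close>, has a preimage.
\<close>

lemma surjective_factor:
  assumes surj: "\<And>n. f n ` carrier (lev M n) = carrier (lev N n)"
    and W: "crossed_complex W" and h: "h \<in> crs_hom M W"
    and h1: "\<And>n x. x \<in> crs_ker M N f n \<Longrightarrow> h n x = \<one>\<^bsub>lev W n\<^esub>"
  shows "\<exists>!u. u \<in> crs_hom N W \<and> Comp Crs M N W u f = h"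
proof -
  interpret W: cc W by (rule cc.intro) fact
  have fib: "h n x = h n y"
    if x: "x \<in> carrier (lev M n)" and y: "y \<in> carrier (lev M n)" and e: "f n x = f n y" for n x y
  proof -
    interpret F: group_hom "lev M n" "lev N n" "f n" by (rule f_group_hom)
    interpret H: group_hom "lev M n" "lev W n" "h n"
      using M.grp W.grp crs_homD(1)[OF h] by (simp add: group_hom_def group_hom_axioms_def)
    have "x \<otimes>\<^bsub>lev M n\<^esub> inv\<^bsub>lev M n\<^esub> y \<in> crs_ker M N f n" using x y e by (simp add: mem_crs_ker)
    from h1[OF this] have "h n x \<otimes>\<^bsub>lev W n\<^esub> inv\<^bsub>lev W n\<^esub> h n y = \<one>\<^bsub>lev W n\<^esub>" using x y by simp
    then show ?thesis
      using x y group.inv_solve_right'[OF W.grp, of "\<one>\<^bsub>lev W n\<^esub>" n "h n x" "h n y"]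
        monoid.one_closed[OF group.is_monoid[OF W.grp]] monoid.l_one[OF group.is_monoid[OF W.grp]]
      by simp
  qed
  define u where "u n = (\<lambda>y\<in>carrier (lev N n). h n (inv_into (carrier (lev M n)) (f n) y))" for n
  have uf: "u n (f n x) = h n x" if x: "x \<in> carrier (lev M n)" for n x
  proof -
    have "f n x \<in> f n ` carrier (lev M n)" using x by blast
    then show ?thesis
      using crs_homD(3)[OF f x] x fib[of "inv_into (carrier (lev M n)) (f n) (f n x)" n x]
      by (simp add: u_def inv_into_into f_inv_into_f)
  qed
  have ex: "\<exists>x\<in>carrier (lev M n). y = f n x" if "y \<in> carrier (lev N n)" for n y
    using that surj[of n] by blast
  have u: "u \<in> crs_hom N W"
  proof (rule crs_homI)
    fix n
    show "u n \<in> extensional (carrier (lev N n))" by (simp add: u_def)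
    show "u n \<in> hom (lev N n) (lev W n)"
    proof (rule homI)
      fix y assume "y \<in> carrier (lev N n)"
      then show "u n y \<in> carrier (lev W n)" using ex uf crs_homD(3)[OF h] by metis
    next
      fix y z assume "y \<in> carrier (lev N n)" "z \<in> carrier (lev N n)"
      then obtain a b where ab: "a \<in> carrier (lev M n)" "y = f n a" "b \<in> carrier (lev M n)" "z = f n b"
        using ex by metis
      have "y \<otimes>\<^bsub>lev N n\<^esub> z = f n (a \<otimes>\<^bsub>lev M n\<^esub> b)"
        using ab hom_mult[OF crs_homD(1)[OF f]] by simp
      then show "u n (y \<otimes>\<^bsub>lev N n\<^esub> z) = u n y \<otimes>\<^bsub>lev W n\<^esub> u n z"
        using ab hom_mult[OF crs_homD(1)[OF h]] monoid.m_closed[OF group.is_monoid[OF M.grp]]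
        by (simp add: uf)
    qed
  next
    fix n y assume n: "1 \<le> (n::nat)" and "y \<in> carrier (lev N n)"
    then obtain x where x: "x \<in> carrier (lev M n)" "y = f n x" using ex by blast
    have "u (n - 1) (bd N n y) = u (n - 1) (f (n - 1) (bd M n x))"
      using x crs_homD(4)[OF f n] by simp
    then show "u (n - 1) (bd N n y) = bd W n (u n y)"
      using x uf M.bdc[OF n x(1)] crs_homD(4)[OF h n] by simp
  next
    fix n c y assume n: "1 \<le> (n::nat)" and "c \<in> carrier (lev N 0)" "y \<in> carrier (lev N n)"
    then obtain b x where b: "b \<in> carrier (lev M 0)" "c = f 0 b"
      and x: "x \<in> carrier (lev M n)" "y = f n x" using ex by metis
    have "u n (act N n c y) = u n (f n (act M n b x))"
      using b x crs_homD(5)[OF f n] by simp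
    then show "u n (act N n c y) = act W n (u 0 c) (u n y)"
      using b x uf M.actc[OF n b(1) x(1)] crs_homD(5)[OF h n] by simp
  qed
  show ?thesis
  proof (rule ex1I[of _ u])
    show "u \<in> crs_hom N W \<and> Comp Crs M N W u f = h"
      using u crs_hom_eqI[OF crs_hom_compose[OF M.cc N.cc W f u] h] uf
      by (simp add: Crs_simps compose_def)
    fix v assume v: "v \<in> crs_hom N W \<and> Comp Crs M N W v f = h"
    show "v = u"
    proof (rule crs_hom_eqI)
      fix n y assume "y \<in> carrier (lev N n)"
      then obtain x where x: "x \<in> carrier (lev M n)" "y = f n x" using ex by blast
      have "h n x = compose (carrier (lev M n)) (v n) (f n) x" using v by (auto simp: Crs_simps)
      then show "v n y = u n y" using x uf by (simp add: compose_def)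
    qed (use u v in auto)
  qed
qed

lemma short_exact_kernel:
  assumes surj: "\<And>n. f n ` carrier (lev M n) = carrier (lev N n)"
  shows "short_exact Crs (sub_crs M (crs_ker M N f)) M N (sub_incl (crs_ker M N f)) f"
proof -
  let ?S = "crs_ker M N f" let ?K = "sub_crs M ?S"
  have "\<exists>!u. u \<in> crs_hom N W \<and> Comp Crs M N W u f = h"
    if W: "crossed_complex W" and h: "h \<in> crs_hom M W"
      and z: "zero_morphism Crs ?K W (Comp Crs ?K M W h (sub_incl ?S))" for W h
  proof (rule surjective_factor[OF surj W h])
    fix n x assume x: "x \<in> ?S n"
    have "compose (?S n) (h n) (sub_incl ?S n) x = \<one>\<^bsub>lev W n\<^esub>"
      using z x zero_morphism_Crs_iff[OF ker.sub_cc W crs_hom_compose[OF ker.sub_cc M.cc W ker.sub_incl_hom h]]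
      by (simp add: Crs_simps)
    then show "h n x = \<one>\<^bsub>lev W n\<^esub>" using x by (simp add: compose_def sub_incl_def)
  qed
  then show ?thesis
    using kernel_Crs N.cc unfolding short_exact_def is_kernel_def is_cokernel_def
    by (auto simp: Crs_simps)
qed

end


section \<open>Truncation is a coreflection\<close>

definition trunc_set :: "nat \<Rightarrow> 'a crs \<Rightarrow> nat \<Rightarrow> 'a set" where
  "trunc_set k M n = (if n \<le> k then carrier (lev M n) else {\<one>\<^bsub>lev M n\<^esub>})"

context cc begin

sublocale trunc: subcomplex M "trunc_set k M" for k
proof (intro subcomplex.intro subcomplex_axioms.intro cc_axioms)
  fix n
  show "subgroup (trunc_set k M n) (lev M n)"
    using group.triv_subgroup[OF grp] group.subgroup_self[OF grp] by (simp add: trunc_set_def)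
next
  fix n x assume n: "1 \<le> (n::nat)" and x: "x \<in> trunc_set k M n"
  show "bd M n x \<in> trunc_set k M (n - 1)"
  proof (cases "n \<le> k")
    case True
    then show ?thesis using bdc[OF n] x by (auto simp: trunc_set_def)
  next
    case False
    then show ?thesis using x hom_one[OF bdh[OF n] grp grp]
        monoid.one_closed[OF group.is_monoid[OF grp]] by (simp add: trunc_set_def)
  qed
next
  fix n b x assume n: "1 \<le> (n::nat)" and b: "b \<in> trunc_set k M 0" and x: "x \<in> trunc_set k M n"
  then show "act M n b x \<in> trunc_set k M n"
    using actc[OF n] hom_one[OF act_hom[OF n] grp grp] by (auto simp: trunc_set_def split: if_splits)
qed

lemma trunc_Crs_le: "sub_crs M (trunc_set k M) \<in> Crs_le k"
  using trunc.sub_cc[of k] trunc.sub_grp[of k]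
  by (simp add: Crs_le_def Crs_simps trivial_group_def trunc_set_def)

text \<open>
  This holds because the source has only units above degree \<open>k\<close>; it is what makes the inclusion of
  the truncation universal among morphisms from \<open>k\<close>-truncated complexes.
\<close>

lemma hom_from_Crs_le:
  assumes A: "A \<in> Crs_le k" and f: "f \<in> crs_hom A M" and x: "x \<in> carrier (lev A n)"
  shows "f n x \<in> trunc_set k M n"
proof (cases "n \<le> k")
  case False
  interpret A: cc A using A by (simp add: Crs_le_def Crs_simps cc_def)
  have "x = \<one>\<^bsub>lev A n\<^esub>" using trivial_groupD[OF _ x] False A by (simp add: Crs_le_def)
  then show ?thesis using hom_one[OF crs_homD(1)[OF f] A.grp grp] False by (simp add: trunc_set_def)
qed (simp add: trunc_set_def crs_homD(3)[OF f x])

end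

definition trunc_functor :: "nat \<Rightarrow> ('a crs, nat \<Rightarrow> 'a \<Rightarrow> 'a, 'a crs, nat \<Rightarrow> 'a \<Rightarrow> 'a) cfunctor" where
  "trunc_functor k = \<lparr>FOb = (\<lambda>M. sub_crs M (trunc_set k M)),
     FHom = (\<lambda>M N f n. restrict (f n) (trunc_set k M n))\<rparr>"

lemma trunc_functor_hom:
  assumes M: "crossed_complex M" and N: "crossed_complex N" and f: "f \<in> crs_hom M N"
  shows "FHom (trunc_functor k) M N f \<in> crs_hom (sub_crs M (trunc_set k M)) (sub_crs N (trunc_set k N))"
proof -
  interpret M: cc M by (rule cc.intro) fact
  interpret N: cc N by (rule cc.intro) fact
  let ?T = "sub_crs M (trunc_set k M)"
  have g: "(\<lambda>n. compose (carrier (lev ?T n)) (f n) (sub_incl (trunc_set k M) n)) \<in> crs_hom ?T N"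
    by (rule crs_hom_compose[OF M.trunc.sub_cc M N M.trunc.sub_incl_hom f])
  have "(\<lambda>n. compose (carrier (lev ?T n)) (f n) (sub_incl (trunc_set k M) n)) = FHom (trunc_functor k) M N f"
    by (auto simp: trunc_functor_def compose_def sub_incl_def restrict_def fun_eq_iff)
  then show ?thesis
    using N.trunc.sub_lift[OF g N.hom_from_Crs_le[OF M.trunc_Crs_le g]] by simp
qed

lemma trunc_adjunction:
  "adjunction Crs (full_subcat Crs (Crs_le k)) inclusion_functor (trunc_functor k)
     (\<lambda>M. sub_incl (trunc_set k M))"
proof -
  note simps = full_subcat_def inclusion_functor_def
  have le: "A \<in> Crs_le k \<Longrightarrow> crossed_complex A" for A :: "'a crs" by (simp add: Crs_le_def Crs_simps)
  have ts: "x \<in> trunc_set k M n \<Longrightarrow> x \<in> carrier (lev M n)" if "crossed_complex M" for M :: "'a crs" and x n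
    by (auto simp: trunc_set_def split: if_splits intro: monoid.one_closed group.is_monoid cc.grp[OF cc.intro[OF that]])
  have FO: "FOb (trunc_functor k) M = sub_crs M (trunc_set k M)" for M :: "'a crs"
    by (simp add: trunc_functor_def)
  have mem: "f n x \<in> trunc_set k N n"
    if "crossed_complex M" "crossed_complex N" "f \<in> crs_hom M N" "x \<in> trunc_set k M n"
    for M N :: "'a crs" and f n x
    using crs_homD(3)[OF trunc_functor_hom[OF that(1-3)], of x k n] that(4) by (simp add: trunc_functor_def)
  have 1: "is_functor (full_subcat Crs (Crs_le k)) Crs (inclusion_functor :: ('a crs, _, _, _) cfunctor)"
    using le by (auto simp: is_functor_def simps Crs_simps)
  have 2: "is_functor Crs (full_subcat Crs (Crs_le k)) (trunc_functor k :: ('a crs, _, _, _) cfunctor)"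
    unfolding is_functor_def
  proof (intro conjI ballI)
    fix M N P :: "'a crs" and f g
    assume "M \<in> Ob Crs" "N \<in> Ob Crs" "f \<in> Hom Crs M N"
    then show "FHom (trunc_functor k) M P (Comp Crs M N P g f) =
       Comp (full_subcat Crs (Crs_le k)) (FOb (trunc_functor k) M) (FOb (trunc_functor k) N)
         (FOb (trunc_functor k) P) (FHom (trunc_functor k) N P g) (FHom (trunc_functor k) M N f)"
      by (auto simp: simps Crs_simps trunc_functor_def compose_def restrict_def fun_eq_iff ts mem)
  qed (auto simp: simps Crs_simps FO cc.intro cc.trunc_Crs_le trunc_functor_hom,
       auto simp: trunc_functor_def restrict_def fun_eq_iff ts)
  have 3: "sub_incl (trunc_set k M) \<in> crs_hom (sub_crs M (trunc_set k M)) M"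
    if "crossed_complex M" for M :: "'a crs"
  proof -
    interpret cc M by (rule cc.intro) fact
    show ?thesis by (rule trunc.sub_incl_hom)
  qed
  show ?thesis
    unfolding adjunction_def
  proof (intro conjI 1 2 ballI)
    fix M :: "'a crs" assume "M \<in> Ob Crs"
    then show "sub_incl (trunc_set k M) \<in> Hom Crs (FOb inclusion_functor (FOb (trunc_functor k) M)) M"
      using 3 by (simp add: simps FO Crs_simps)
  next
    fix M N :: "'a crs" and f assume "M \<in> Ob Crs" "N \<in> Ob Crs" "f \<in> Hom Crs M N"
    then show "Comp Crs (FOb inclusion_functor (FOb (trunc_functor k) M))
          (FOb inclusion_functor (FOb (trunc_functor k) N)) N (sub_incl (trunc_set k N))
          (FHom inclusion_functor (FOb (trunc_functor k) M) (FOb (trunc_functor k) N) (FHom (trunc_functor k) M N f)) =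
       Comp Crs (FOb inclusion_functor (FOb (trunc_functor k) M)) M N f (sub_incl (trunc_set k M))"
      by (auto simp: simps trunc_functor_def Crs_simps compose_def sub_incl_def restrict_def fun_eq_iff mem)
  next
    fix A M :: "'a crs" and f
    assume "A \<in> Ob (full_subcat Crs (Crs_le k))" "M \<in> Ob Crs" "f \<in> Hom Crs (FOb inclusion_functor A) M"
    then have A: "A \<in> Crs_le k" and M: "crossed_complex M" and f: "f \<in> crs_hom A M"
      by (simp_all add: simps Crs_simps)
    interpret M: cc M by (rule cc.intro) fact
    show "\<exists>!g. g \<in> Hom (full_subcat Crs (Crs_le k)) A (FOb (trunc_functor k) M) \<and>
       Comp Crs (FOb inclusion_functor A) (FOb inclusion_functor (FOb (trunc_functor k) M)) M
         (sub_incl (trunc_set k M)) (FHom inclusion_functor A (FOb (trunc_functor k) M) g) = f"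
      using M.trunc.sub_incl_lift[OF f M.hom_from_Crs_le[OF A f]]
      by (simp add: simps FO Crs_simps)
  qed
qed

lemma mono_coreflective_Crs_le: "mono_coreflective Crs (Crs_le k :: 'a crs set)"
proof -
  have "monomorphism Crs (FOb (trunc_functor k) M) M (sub_incl (trunc_set k M))"
    if "M \<in> Ob Crs" for M :: "'a crs"
  proof -
    interpret cc M using that by (simp add: Crs_simps cc_def)
    show ?thesis using trunc.sub_incl_monomorphism by (simp add: trunc_functor_def)
  qed
  then show ?thesis
    unfolding mono_coreflective_def using trunc_adjunction by (auto simp: Crs_le_def)
qed


section \<open>The torsion theory of the reflection\<close>

lemma (in normal) trivial_rep_Mod_iff: "trivial_group (rep_Mod G H) \<longleftrightarrow> H = carrier G"
proof
  assume t: "trivial_group (rep_Mod G H)"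
  have "x \<in> H" if x: "x \<in> carrier G" for x
  proof -
    have "rep (H #> x) = rep (H #> \<one>)"
      using trivial_groupD[OF t rep_in_rep_Mod[OF x]] by (simp add: rep_Mod_one)
    then have "H #> x = H #> \<one>" using rep_eq_iff x by simp
    then show ?thesis using x rcos_self[OF x subgroup_axioms] subset by simp
  qed
  then show "H = carrier G" using subset by blast
next
  assume H: "H = carrier G"
  have "rep (H #> x) = rep (H #> \<one>)" if "x \<in> carrier G" for x
    using that H rcos_const[OF is_group] by simp
  then have "carrier (rep_Mod G H) = (\<lambda>x. rep (H #> \<one>)) ` carrier G"
    unfolding carrier_rep_Mod by (intro image_cong refl)
  also have "\<dots> = {\<one>\<^bsub>rep_Mod G H\<^esub>}" using one_closed rep_Mod_one by auto
  finally show "trivial_group (rep_Mod G H)"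
    using group_rep_Mod by (simp add: trivial_group_def)
qed

text \<open>
  The vanishing of \<open>cot k M\<close> is a condition in degrees \<open>\<le> k\<close> only, and in degree \<open>k\<close> it says that the
  quotient by the image of the differential collapses.
\<close>

lemma Ker_cot_iff:
  assumes k: "1 \<le> k" and M: "crossed_complex M"
  shows "M \<in> Ker_cot k \<longleftrightarrow> (\<forall>i<k. trivial_group (lev M i)) \<and> bd_image M k = carrier (lev M k)"
proof -
  interpret cc M by (rule cc.intro) fact
  have "(\<forall>i. trivial_group (cot_lev k M i)) \<longleftrightarrow>
      (\<forall>i<k. trivial_group (lev M i)) \<and> trivial_group (rep_Mod (lev M k) (bd_image M k))"
    by (metis cot_lev_simps linorder_neqE_nat trivial_singleton)
  moreover have "lev (cot k M) = cot_lev k M" by (simp add: cot_def)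
  ultimately show ?thesis
    using M cot_cc[OF k] by (simp add: Ker_cot_def Crs_simps zero_object_Crs_iff im.trivial_rep_Mod_iff)
qed

lemma isomorphic_Crs_sym: "isomorphic Crs M N \<Longrightarrow> isomorphic Crs N M"
  by (auto simp: isomorphic_def)

lemma replete_Crs_le: "replete Crs (Crs_le k)"
  unfolding replete_def using isomorphic_trivial isomorphic_Crs_sym
  by (fastforce simp: Crs_le_def)

lemma replete_Ker_cot:
  assumes k: "1 \<le> k"
  shows "replete Crs (Ker_cot k)"
  unfolding replete_def
proof (intro conjI ballI impI)
  show "Ker_cot k \<subseteq> Ob Crs" by (auto simp: Ker_cot_def)
  fix M N :: "'a crs" assume M: "M \<in> Ker_cot k" and N: "N \<in> Ob Crs" and i: "isomorphic Crs M N"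
  have cM: "crossed_complex M" and cN: "crossed_complex N" using M N by (auto simp: Ker_cot_def Crs_simps)
  interpret N: cc N by (rule cc.intro) fact
  obtain f g where f: "f \<in> crs_hom M N" and g: "g \<in> crs_hom N M"
    and fg: "(\<lambda>n. compose (carrier (lev N n)) (f n) (g n)) = (\<lambda>n. \<lambda>x\<in>carrier (lev N n). x)"
    using i by (auto simp: isomorphic_def Crs_simps)
  note * = M[unfolded Ker_cot_iff[OF k cM]]
  have "y \<in> bd_image N k" if y: "y \<in> carrier (lev N k)" for y
  proof -
    have "g k y \<in> bd_image M k" using * crs_homD(3)[OF g y] by simp
    then obtain x where x: "x \<in> carrier (lev M (k + 1))" "g k y = bd M (k + 1) x"
      by (auto simp: bd_image_def)
    have "compose (carrier (lev N k)) (f k) (g k) y = (\<lambda>x\<in>carrier (lev N k). x) y" using fg by metis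
    then have "y = f k (bd M (k + 1) x)" using x y by (simp add: compose_def)
    also have "\<dots> = bd N (k + 1) (f (k + 1) x)" using crs_homD(4)[OF f _ x(1)] by simp
    finally show ?thesis using crs_homD(3)[OF f x(1)] by (auto simp: bd_image_def)
  qed
  moreover have "bd_image N k \<subseteq> carrier (lev N k)" using N.im.subset by blast
  moreover have "trivial_group (lev N i)" if "i < k" for i
    using isomorphic_trivial[OF N _ isomorphic_Crs_sym[OF i]] * that cM by (simp add: Crs_simps)
  ultimately show "N \<in> Ker_cot k" unfolding Ker_cot_iff[OF k cN] by blast
qed

lemma TT1_Ker_cot:
  assumes k: "1 \<le> k"
  shows "TT1 Crs (Ker_cot k) (Crs_le k)"
  unfolding TT1_def Crs_simps
proof (intro ballI)
  fix T F :: "'a crs" and f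
  assume T: "T \<in> Ker_cot k" and F: "F \<in> Crs_le k" and f: "f \<in> crs_hom T F"
  have cT: "crossed_complex T" and cF: "crossed_complex F"
    using T F by (auto simp: Ker_cot_def Crs_le_def Crs_simps)
  interpret T: cc T by (rule cc.intro) fact
  interpret F: cc F by (rule cc.intro) fact
  note * = T[unfolded Ker_cot_iff[OF k cT]]
  have Ft: "trivial_group (lev F n)" if "n > k" for n using F that by (simp add: Crs_le_def)
  have "f n x = \<one>\<^bsub>lev F n\<^esub>" if x: "x \<in> carrier (lev T n)" for n x
  proof -
    consider "n < k" | "n = k" | "n > k" by linarith
    then show ?thesis
    proof cases
      case 1
      then have "x = \<one>\<^bsub>lev T n\<^esub>" using trivial_groupD[OF _ x] * by simp
      then show ?thesis using hom_one[OF crs_homD(1)[OF f] T.grp F.grp] by simp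
    next
      case 3 then show ?thesis using trivial_groupD[OF Ft crs_homD(3)[OF f x]] by simp
    next
      case 2
      then have "x \<in> bd_image T k" using * x by simp
      then obtain y where y: "y \<in> carrier (lev T (k + 1))" "x = bd T (k + 1) y"
        by (auto simp: bd_image_def)
      have "f k x = bd F (k + 1) (f (k + 1) y)" using crs_homD(4)[OF f _ y(1)] y by simp
      also have "f (k + 1) y = \<one>\<^bsub>lev F (k + 1)\<^esub>" using trivial_groupD[OF Ft crs_homD(3)[OF f y(1)]] by simp
      also have "bd F (k + 1) \<dots> = \<one>\<^bsub>lev F k\<^esub>" using hom_one[OF F.bdh[of "k + 1"] F.grp F.grp] by simp
      finally show ?thesis using 2 by simp
    qed
  qed
  then show "zero_morphism Crs T F f" using zero_morphism_Crs_iff[OF cT cF f] by blast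
qed

text \<open>
  The torsion part of \<open>M\<close> is the kernel of the reflection \<open>M \<rightarrow> cot k M\<close>. In degree \<open>k\<close> it consists of
  boundaries, and it keeps all of degree \<open>k + 1\<close>, so that each of these is still a boundary in it.
\<close>

lemma TT2_Ker_cot:
  assumes k: "1 \<le> k"
  shows "TT2_on Crs (Ob Crs) (Ker_cot k) (Crs_le k)"
  unfolding TT2_on_def
proof
  fix M :: "'a crs" assume "M \<in> Ob Crs"
  then have cM: "crossed_complex M" by (simp add: Crs_simps)
  interpret M: cc M by (rule cc.intro) fact
  interpret crs_morphism M "cot k M" "cot_unit k M"
    using M.cot_cc[OF k] M.cot_unit_hom[OF k] by unfold_locales
  let ?S = "crs_ker M (cot k M) (cot_unit k M)"
  have L: "lev (cot k M) = cot_lev k M" by (simp add: cot_def)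
  have one: "\<one>\<^bsub>lev M i\<^esub> \<in> carrier (lev M i)" for i
    by (rule monoid.one_closed[OF group.is_monoid[OF M.grp]])
  have S: "?S i = {\<one>\<^bsub>lev M i\<^esub>}" if "i < k" for i
    using that one by (auto simp: mem_crs_ker L cot_unit_def)
  have Sk: "?S k = bd_image M k"
  proof -
    have "rep (bd_image M k #>\<^bsub>lev M k\<^esub> x) = rep (bd_image M k #>\<^bsub>lev M k\<^esub> \<one>\<^bsub>lev M k\<^esub>) \<longleftrightarrow> x \<in> bd_image M k"
      if "x \<in> carrier (lev M k)" for x
    proof -
      have "bd_image M k #>\<^bsub>lev M k\<^esub> \<one>\<^bsub>lev M k\<^esub> = bd_image M k"
        by (rule M.im.rcos_const[OF M.grp subgroup.one_closed[OF M.im.subgroup_axioms]])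
      then show ?thesis
        using M.im.rep_eq_iff[OF that one] M.im.rcos_const[OF M.grp] 
          group.rcos_self[OF M.grp that M.im.subgroup_axioms] by metis
    qed
    then show ?thesis using M.im.subset by (auto simp: mem_crs_ker L cot_unit_def M.im.rep_Mod_one)
  qed
  have Sk1: "?S (k + 1) = carrier (lev M (k + 1))"
    by (auto simp: mem_crs_ker L cot_unit_def singleton_group_def)
  have "sub_crs M ?S \<in> Ker_cot k"
    unfolding Ker_cot_iff[OF k ker.sub_cc]
    using S Sk Sk1 ker.sub_grp by (simp add: trivial_group_def) (simp add: bd_image_def)
  moreover have "cot_unit k M n ` carrier (lev M n) = carrier (lev (cot k M) n)" for n
  proof -
    consider "n < k" | "n = k" | "n > k" by linarith
    then show ?thesis
    proof cases
      case 2 then show ?thesis by (simp add: L cot_unit_def M.im.carrier_rep_Mod)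
    qed (use one in \<open>auto simp: L cot_unit_def singleton_group_def image_iff\<close>)
  qed
  ultimately show "\<exists>T\<in>Ker_cot k. \<exists>F\<in>Crs_le k. \<exists>t q. short_exact Crs T M F t q"
    using short_exact_kernel M.cot_Crs_le[OF k] by blast
qed

lemma CTF_theory_Ker_cot: "1 \<le> k \<Longrightarrow> CTF_theory Crs (Ker_cot k) (Crs_le k)"
  unfolding CTF_theory_def torsion_theory_def
  using replete_Ker_cot replete_Crs_le TT1_Ker_cot TT2_Ker_cot mono_coreflective_Crs_le by blast


section \<open>Complexes with trivial actions in high degrees\<close>

text \<open>
  The part in degrees \<open>\<ge> n\<close> is the quotient of \<open>M\<close> by its part below and in general not a
  subcomplex, so the differential out of degree \<open>n\<close> has to be replaced by the trivial one.
\<close>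

definition upper_chn :: "nat \<Rightarrow> 'a crs \<Rightarrow> 'a chn" where
  "upper_chn n M = \<lparr>clev = (\<lambda>i. if i < n then singleton_group \<one>\<^bsub>lev M i\<^esub> else lev M i),
     cbd = (\<lambda>i x. if i \<le> n then \<one>\<^bsub>lev M (i - 1)\<^esub> else bd M i x)\<rparr>"

definition upper_proj :: "nat \<Rightarrow> 'a crs \<Rightarrow> nat \<Rightarrow> 'a \<Rightarrow> 'a" where
  "upper_proj n M i = (\<lambda>x\<in>carrier (lev M i). if i < n then \<one>\<^bsub>lev M i\<^esub> else x)"

context cc begin

lemma upper_chn_Ob:
  assumes n: "2 \<le> n"
  shows "upper_chn n M \<in> Ob (ChnAb_ge n)"
proof -
  let ?A = "upper_chn n M"
  have one: "\<one>\<^bsub>clev ?A i\<^esub> = \<one>\<^bsub>lev M i\<^esub>" for i by (simp add: upper_chn_def singleton_group_def)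
  have comm': "comm_group (clev ?A i)" for i
    using comm n by (simp add: upper_chn_def)
  have g: "group (clev ?A i)" for i using comm'[of i] by (simp add: comm_group_def)
  have bdh': "cbd ?A i \<in> hom (clev ?A i) (clev ?A (i - 1))" if i: "1 \<le> i" for i
  proof (cases "i \<le> n")
    case True
    then have "cbd ?A i = (\<lambda>x. \<one>\<^bsub>clev ?A (i - 1)\<^esub>)" using one by (auto simp: upper_chn_def)
    then show ?thesis using one_hom(1)[OF g] by metis
  next
    case False
    then have "\<not> i - 1 < n" by simp
    with False show ?thesis using bdh[OF i] by (simp add: upper_chn_def)
  qed
  have "cbd ?A i (cbd ?A (i + 1) x) = \<one>\<^bsub>clev ?A (i - 1)\<^esub>"
    if i: "1 \<le> i" and x: "x \<in> carrier (clev ?A (i + 1))" for i x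
    using bdbd[OF i, of x] x unfolding one by (auto simp: upper_chn_def)
  then show ?thesis
    using comm' bdh' trivial_singleton by (simp add: ChnAb_ge_def chain_complex_def)
      (simp add: upper_chn_def)
qed

text \<open>
  The projection sends \<open>b\<close> in \<open>M\<^sub>0\<close> to the unit, so in degree \<open>i \<ge> n\<close> equivariance asks precisely that
  \<open>b\<close> fixes \<open>M\<^sub>i\<close>.
\<close>

lemma upper_proj_hom:
  assumes n: "2 \<le> n" and t: "M \<in> Crs_trivial_act n"
  shows "upper_proj n M \<in> crs_hom M (FOb chn_to_crs (upper_chn n M))"
proof (rule crs_homI)
  fix i
  show "upper_proj n M i \<in> extensional (carrier (lev M i))" by (simp add: upper_proj_def)
  show "upper_proj n M i \<in> hom (lev M i) (lev (FOb chn_to_crs (upper_chn n M)) i)"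
    using monoid.m_closed[OF group.is_monoid[OF grp[of i]]]
    by (auto intro!: homI simp: upper_proj_def chn_to_crs_def upper_chn_def singleton_group_def)
next
  fix i x assume i: "1 \<le> (i::nat)" and x: "x \<in> carrier (lev M i)"
  then show "upper_proj n M (i - 1) (bd M i x) =
      bd (FOb chn_to_crs (upper_chn n M)) i (upper_proj n M i x)"
    using bdc[OF i x] by (auto simp: upper_proj_def chn_to_crs_def upper_chn_def)
next
  fix i b x assume i: "1 \<le> (i::nat)" and b: "b \<in> carrier (lev M 0)" and x: "x \<in> carrier (lev M i)"
  have "act M i b x = x" if "n \<le> i"
    using t that b x by (simp add: Crs_trivial_act_def one_AutoGroup)
  then show "upper_proj n M i (act M i b x) =
      act (FOb chn_to_crs (upper_chn n M)) i (upper_proj n M 0 b) (upper_proj n M i x)"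
    using actc[OF i b x] x by (auto simp: upper_proj_def chn_to_crs_def upper_chn_def singleton_group_def)
qed

end

text \<open>
  The kernel of the projection is the part of \<open>M\<close> in degrees \<open>< n\<close>, and its target is
  presented as a chain complex of abelian groups, which is possible since \<open>n \<ge> 2\<close>.
\<close>

lemma TT2_Crs_ge:
  assumes n: "2 \<le> n"
  shows "TT2_on Crs (Crs_trivial_act n) (Crs_le (n - 1)) (Crs_ge n)"
  unfolding TT2_on_def
proof
  fix M :: "'a crs" assume t: "M \<in> Crs_trivial_act n"
  then interpret M: cc M by (simp add: Crs_trivial_act_def Crs_simps cc_def)
  let ?F = "FOb chn_to_crs (upper_chn n M)"
  have F: "?F \<in> Crs_ge n" using chn_to_crs_Crs_ge[OF _ M.upper_chn_Ob[OF n]] n by simp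
  interpret crs_morphism M ?F "upper_proj n M"
    using F M.upper_proj_hom[OF n t] by unfold_locales (simp_all add: Crs_ge_def Crs_simps)
  let ?S = "crs_ker M ?F (upper_proj n M)"
  have L: "lev ?F i = (if i < n then singleton_group \<one>\<^bsub>lev M i\<^esub> else lev M i)" for i
    by (simp add: chn_to_crs_def upper_chn_def)
  have one: "\<one>\<^bsub>lev M i\<^esub> \<in> carrier (lev M i)" for i
    by (rule monoid.one_closed[OF group.is_monoid[OF M.grp]])
  have "?S i = {\<one>\<^bsub>lev M i\<^esub>}" if "i > n - 1" for i
  proof -
    have "\<not> i < n" using that by linarith
    then show ?thesis using one by (auto simp: mem_crs_ker L upper_proj_def)
  qed
  then have "sub_crs M ?S \<in> Crs_le (n - 1)"
    using ker.sub_cc ker.sub_grp by (simp add: Crs_le_def Crs_simps trivial_group_def)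
  moreover have "upper_proj n M i ` carrier (lev M i) = carrier (lev ?F i)" for i
    using one[of i] by (auto simp: L upper_proj_def singleton_group_def image_iff)
  ultimately show "\<exists>T\<in>Crs_le (n - 1). \<exists>F\<in>Crs_ge n. \<exists>t q. short_exact Crs T M F t q"
    using short_exact_kernel F by blast
qed

lemma TT1_Crs_ge:
  assumes n: "1 \<le> n"
  shows "TT1 Crs (Crs_le (n - 1)) (Crs_ge n)"
  unfolding TT1_def Crs_simps
proof (intro ballI)
  fix T F :: "'a crs" and f
  assume T: "T \<in> Crs_le (n - 1)" and F: "F \<in> Crs_ge n" and f: "f \<in> crs_hom T F"
  have cT: "crossed_complex T" and cF: "crossed_complex F"
    using T F by (auto simp: Crs_ge_def Crs_le_def Crs_simps)
  interpret T: cc T by (rule cc.intro) fact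
  interpret F: cc F by (rule cc.intro) fact
  have "f i x = \<one>\<^bsub>lev F i\<^esub>" if x: "x \<in> carrier (lev T i)" for i x
  proof (cases "i < n")
    case True
    then show ?thesis using trivial_groupD[OF _ crs_homD(3)[OF f x]] F by (simp add: Crs_ge_def)
  next
    case False
    then have "i > n - 1" using n by linarith
    then have "x = \<one>\<^bsub>lev T i\<^esub>" using trivial_groupD[OF _ x] T by (simp add: Crs_le_def)
    then show ?thesis using hom_one[OF crs_homD(1)[OF f] T.grp F.grp] by simp
  qed
  then show "zero_morphism Crs T F f" using zero_morphism_Crs_iff[OF cT cF f] by blast
qed

lemma E_torsion_theory_Crs_ge:
  "2 \<le> n \<Longrightarrow> E_torsion_theory Crs (Crs_trivial_act n) (Crs_le (n - 1)) (Crs_ge n)"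
  unfolding E_torsion_theory_def using TT1_Crs_ge[of n] TT2_Crs_ge[of n]
  by (auto simp: Crs_trivial_act_def Crs_le_def Crs_ge_def)

text \<open>
  Every element of \<open>M\<^sub>0\<close> is of the form \<open>\<delta>\<^sub>1 x\<close>, and such elements act trivially from degree \<open>2\<close> on.
\<close>

lemma central_extension_trivial_act:
  assumes n: "2 \<le> n" and M: "M \<in> Ob Crs" and c: "central_extension (lev M 1) (lev M 0) (bd M 1)"
  shows "M \<in> Crs_trivial_act n"
proof -
  interpret cc M using M by (simp add: Crs_simps cc_def)
  have "act M i b = \<one>\<^bsub>AutoGroup (lev M i)\<^esub>" if "n \<le> i" and b: "b \<in> carrier (lev M 0)" for i b
  proof -
    obtain x where "x \<in> carrier (lev M 1)" "b = bd M 1 x"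
      using c b unfolding central_extension_def by blast
    then show ?thesis using act_bd1 n \<open>n \<le> i\<close> by simp
  qed
  then show ?thesis using M by (simp add: Crs_trivial_act_def)
qed

theorem proposition6p13:
  fixes n :: nat
  assumes "n \<ge> 2"
  shows
    "CTF_theory (Crs :: ('a crs, nat \<Rightarrow> 'a \<Rightarrow> 'a) cat) (Ker_cot (n - 1)) (Crs_le (n - 1)) \<and>
     E_torsion_theory (Crs :: ('a crs, nat \<Rightarrow> 'a \<Rightarrow> 'a) cat)
       (Crs_trivial_act n) (Crs_le (n - 1)) (Crs_ge n) \<and>
     (\<forall>M :: 'a crs. M \<in> Ob Crs \<and> central_extension (lev M 1) (lev M 0) (bd M 1) \<longrightarrow>
        M \<in> Crs_trivial_act n) \<and>
     CTF_theory (Crs :: ('a crs, nat \<Rightarrow> 'a \<Rightarrow> 'a) cat)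
       (Ker_cot 1) (essential_image XMod Crs sk1) \<and>
     E_torsion_theory (Crs :: ('a crs, nat \<Rightarrow> 'a \<Rightarrow> 'a) cat)
       (Crs_trivial_act 2) (essential_image XMod Crs sk1)
       (essential_image (ChnAb_ge 2) Crs chn_to_crs)"
  using CTF_theory_Ker_cot[of "n - 1", where ?'a = 'a] CTF_theory_Ker_cot[of 1] assms
    E_torsion_theory_Crs_ge[of n] E_torsion_theory_Crs_ge[of 2] central_extension_trivial_act[of n]
  by (auto simp: essential_image_sk1 essential_image_chn_to_crs)

end
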